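(* Let $\rho:\mathfrak g\to\mathrm{Der}(\mathfrak h)$ be a coherent action of a Lie algebra $(\mathfrak g,[-,-]_{\mathfrak g})$ on a Lie algebra $(\mathfrak h,[-,-]_{\mathfrak h})$. Let $C^*(\mathfrak h,\mathfrak g)=\bigoplus_{n=1}^{+\infty}\mathrm{Hom}(\otimes^n\mathfrak h,\mathfrak g)$, with the bracket $\{\!\{-,-\}\!\}$ and the linear map $\mathrm d$ defined in the context. Then $(C^*(\mathfrak h,\mathfrak g),\{\!\{-,-\}\!\},\mathrm d)$ is a differential graded Lie algebra, and its Maurer-Cartan elements are exactly the nonabelian embedding tensors on $\mathfrak g$ with respect to the coherent action $(\mathfrak h;\rho)$.
   Context: All vector spaces are over a fixed field of characteristic zero. A coherent action of a Lie algebra $\mathfrak g$ on a Lie algebra $\mathfrak h$, denoted $(\mathfrak h;\rho)$, is a Lie algebra homomorphism $\rho:\mathfrak g\to\mathrm{Der}(\mathfrak h)$ such that $[\rho(x)u,v]_{\mathfrak h}=0$ for all $x\in\mathfrak g$, $u,v\in\mathfrak h$. A nonabelian embedding tensor on $\mathfrak g$ with respect to $(\mathfrak h;\rho)$ is a linear map $T:\mathfrak h\to\mathfrak g$ with $[Tu,Tv]_{\mathfrak g}=T\big(\rho(Tu)(v)+[u,v]_{\mathfrak h}\big)$ for all $u,v\in\mathfrak h$. $\mathbb S_{(i,j)}$ denotes the set of permutations $\sigma\in\mathbb S_{i+j}$ with $\sigma(1)<\cdots<\sigma(i)$ and $\sigma(i+1)<\cdots<\sigma(i+j)$ (only the identity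 if $i=0$ or $j=0$), and $(-1)^\sigma$ is the sign of $\sigma$. In $C^*(\mathfrak h,\mathfrak g)$ the space $\mathrm{Hom}(\otimes^n\mathfrak h,\mathfrak g)$ has degree $n$. The map $\mathrm d:\mathrm{Hom}(\otimes^n\mathfrak h,\mathfrak g)\to\mathrm{Hom}(\otimes^{n+1}\mathfrak h,\mathfrak g)$ is $$(\mathrm d f)(v_1,\ldots,v_{n+1})=\sum_{1\le i<j\le n+1}(-1)^{n-1+i}f(v_1,\ldots,\hat v_i,\ldots,v_{j-1},[v_i,v_j]_{\mathfrak h},v_{j+1},\ldots,v_{n+1}).$$ The bracket $\{\!\{-,-\}\!\}:\mathrm{Hom}(\otimes^m\mathfrak h,\mathfrak g)\times\mathrm{Hom}(\otimes^n\mathfrak h,\mathfrak g)\to\mathrm{Hom}(\otimes^{m+n}\mathfrak h,\mathfrak g)$ is $$\begin{aligned}\{\!\{\theta,\phi\}\!\}(v_1,\ldots,v_{m+n})=&\sum_{k=1}^{m}\sum_{\sigma\in\mathbb S_{(k-1,n)}}(-1)^{(k-1)n+1}(-1)^\sigma\theta\big(v_{\sigma(1)},\ldots,v_{\sigma(k-1)},\rho(\phi(v_{\sigma(k)},\ldots,v_{\sigma(k+n-1)}))v_{k+n},v_{k+n+1},\ldots,v_{m+n}\big)\\&+\sum_{\sigma\in\mathbb S_{(m,n)}}(-1)^{mn+1}(-1)^\sigma[\theta(v_{\sigma(1)},\ldots,v_{\sigma(m)}),\phi(v_{\sigma(m+1)},\ldots,v_{\sigma(m+n)})]_{\mathfrak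 g}\\&+\sum_{k=1}^{n}\sum_{\sigma\in\mathbb S_{(k-1,m)}}(-1)^{m(k+n-1)}(-1)^\sigma\phi\big(v_{\sigma(1)},\ldots,v_{\sigma(k-1)},\rho(\theta(v_{\sigma(k)},\ldots,v_{\sigma(k+m-1)}))v_{k+m},v_{k+m+1},\ldots,v_{m+n}\big).\end{aligned}$$ A Maurer-Cartan element of a differential graded Lie algebra $(L,[-,-],d)$ is an element $\alpha$ of degree $1$ with $d\alpha+\frac12[\alpha,\alpha]=0$; here degree $1$ means $\alpha\in\mathrm{Hom}(\mathfrak h,\mathfrak g)$. *)

theory Defs
  imports
    Complex_Main
    "HOL-Combinatorics.Permutations"
    "HOL-Library.Function_Algebras"
begin

section \<open>Lie algebras, coherent actions and nonabelian embedding tensors\<close>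

locale lie_algebra = vector_space scale
  for scale :: "'k::field \<Rightarrow> 'a::ab_group_add \<Rightarrow> 'a" +
  fixes bracket :: "'a \<Rightarrow> 'a \<Rightarrow> 'a"
  assumes linear_left: "Vector_Spaces.linear scale scale (\<lambda>x. bracket x y)"
    and linear_right: "Vector_Spaces.linear scale scale (bracket x)"
    and alternating: "bracket x x = 0"
    and jacobi: "bracket x (bracket y z) + bracket y (bracket z x) + bracket z (bracket x y) = 0"

definition derivations ::
  "('k::field \<Rightarrow> 'h::ab_group_add \<Rightarrow> 'h) \<Rightarrow> ('h \<Rightarrow> 'h \<Rightarrow> 'h) \<Rightarrow> ('h \<Rightarrow> 'h) set" where
  "derivations sh brh =
     {D. Vector_Spaces.linear sh sh D \<and> (\<forall>u v. D (brh u v) = brh (D u) v + brh u (D v))}"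

text \<open>The first three assumptions say that \<open>\<rho>\<close> is a Lie algebra homomorphism into the derivations
  of \<open>\<hh>\<close> with the commutator bracket.\<close>

locale coherent_action =
  g: lie_algebra sg brg + h: lie_algebra sh brh
  for sg :: "'k::field \<Rightarrow> 'g::ab_group_add \<Rightarrow> 'g" and brg :: "'g \<Rightarrow> 'g \<Rightarrow> 'g"
    and sh :: "'k \<Rightarrow> 'h::ab_group_add \<Rightarrow> 'h" and brh :: "'h \<Rightarrow> 'h \<Rightarrow> 'h" +
  fixes \<rho> :: "'g \<Rightarrow> 'h \<Rightarrow> 'h"
  assumes rho_derivation: "\<rho> x \<in> derivations sh brh"
    and rho_linear: "Vector_Spaces.linear sg (\<lambda>c D u. sh c (D u)) \<rho>"
    and rho_bracket: "\<rho> (brg x y) = (\<lambda>u. \<rho> x (\<rho> y u) - \<rho> y (\<rho> x u))"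
    and coherent: "brh (\<rho> x u) v = 0"

definition nonabelian_embedding_tensor ::
  "('k::field \<Rightarrow> 'g::ab_group_add \<Rightarrow> 'g) \<Rightarrow> ('g \<Rightarrow> 'g \<Rightarrow> 'g) \<Rightarrow>
   ('k \<Rightarrow> 'h::ab_group_add \<Rightarrow> 'h) \<Rightarrow> ('h \<Rightarrow> 'h \<Rightarrow> 'h) \<Rightarrow> ('g \<Rightarrow> 'h \<Rightarrow> 'h) \<Rightarrow> ('h \<Rightarrow> 'g) \<Rightarrow> bool" where
  "nonabelian_embedding_tensor sg brg sh brh \<rho> T \<longleftrightarrow>
     Vector_Spaces.linear sh sg T \<and>
     (\<forall>u v. brg (T u) (T v) = T (\<rho> (T u) v + brh u v))"

section \<open>Differential graded Lie algebras\<close>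

text \<open>\<open>V\<close> is the internal direct sum of the subspaces \<open>deg p\<close>.\<close>

locale graded_vector_space = vector_space scale
  for scale :: "'k::field \<Rightarrow> 'v::ab_group_add \<Rightarrow> 'v" +
  fixes V :: "'v set" and deg :: "int \<Rightarrow> 'v set"
  assumes subspace_V: "subspace V"
    and subspace_deg: "subspace (deg p)"
    and deg_subset: "deg p \<subseteq> V"
    and direct_sum: "x \<in> V \<Longrightarrow>
      \<exists>!c. (\<forall>p. c p \<in> deg p) \<and> finite {p. c p \<noteq> 0} \<and> x = (\<Sum>p | c p \<noteq> 0. c p)"

locale dg_lie_algebra = graded_vector_space scale V deg
  for scale :: "'k::field \<Rightarrow> 'v::ab_group_add \<Rightarrow> 'v" and V :: "'v set" and deg :: "int \<Rightarrow> 'v set" +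
  fixes br :: "'v \<Rightarrow> 'v \<Rightarrow> 'v" and d :: "'v \<Rightarrow> 'v"
  assumes br_add_left: "\<lbrakk>x \<in> V; y \<in> V; z \<in> V\<rbrakk> \<Longrightarrow> br (x + y) z = br x z + br y z"
    and br_add_right: "\<lbrakk>x \<in> V; y \<in> V; z \<in> V\<rbrakk> \<Longrightarrow> br x (y + z) = br x y + br x z"
    and br_scale_left: "\<lbrakk>x \<in> V; y \<in> V\<rbrakk> \<Longrightarrow> br (scale c x) y = scale c (br x y)"
    and br_scale_right: "\<lbrakk>x \<in> V; y \<in> V\<rbrakk> \<Longrightarrow> br x (scale c y) = scale c (br x y)"
    and br_deg: "\<lbrakk>x \<in> deg p; y \<in> deg q\<rbrakk> \<Longrightarrow> br x y \<in> deg (p + q)"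
    and br_antisym: "\<lbrakk>x \<in> deg p; y \<in> deg q\<rbrakk> \<Longrightarrow>
      br x y = - scale ((-1) powi (p * q)) (br y x)"
    and br_jacobi: "\<lbrakk>x \<in> deg p; y \<in> deg q; z \<in> deg r\<rbrakk> \<Longrightarrow>
      br x (br y z) = br (br x y) z + scale ((-1) powi (p * q)) (br y (br x z))"
    and d_add: "\<lbrakk>x \<in> V; y \<in> V\<rbrakk> \<Longrightarrow> d (x + y) = d x + d y"
    and d_scale: "x \<in> V \<Longrightarrow> d (scale c x) = scale c (d x)"
    and d_deg: "x \<in> deg p \<Longrightarrow> d x \<in> deg (p + 1)"
    and d_d: "x \<in> V \<Longrightarrow> d (d x) = 0"
    and d_br: "\<lbrakk>x \<in> deg p; y \<in> deg q\<rbrakk> \<Longrightarrow>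
      d (br x y) = br (d x) y + scale ((-1) powi p) (br x (d y))"

definition maurer_cartan ::
  "('k::field \<Rightarrow> 'v::ab_group_add \<Rightarrow> 'v) \<Rightarrow> (int \<Rightarrow> 'v set) \<Rightarrow> ('v \<Rightarrow> 'v \<Rightarrow> 'v) \<Rightarrow> ('v \<Rightarrow> 'v) \<Rightarrow> 'v \<Rightarrow> bool" where
  "maurer_cartan scale deg br d \<alpha> \<longleftrightarrow> \<alpha> \<in> deg 1 \<and> d \<alpha> + scale (1 / 2) (br \<alpha> \<alpha>) = 0"

section \<open>The graded space of cochains\<close>

text \<open>An element of \<open>Hom(\<otimes>\<^sup>n\<hh>, \<gg>)\<close> is represented by the corresponding \<open>n\<close>-linear map, as a
  function on lists vanishing off lists of length \<open>n\<close>. An element \<open>f\<close> of the direct sum over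
  \<open>n \<ge> 1\<close> is then a function on lists of arbitrary length, whose component of degree \<open>n\<close> is its
  restriction to lists of length \<open>n\<close>.\<close>

definition hom_tensor ::
  "('k::field \<Rightarrow> 'h::ab_group_add \<Rightarrow> 'h) \<Rightarrow> ('k \<Rightarrow> 'g::ab_group_add \<Rightarrow> 'g) \<Rightarrow> nat \<Rightarrow> ('h list \<Rightarrow> 'g) set" where
  "hom_tensor sh sg n =
     {f. (\<forall>vs. length vs \<noteq> n \<longrightarrow> f vs = 0) \<and>
         (\<forall>vs i. length vs = n \<longrightarrow> i < n \<longrightarrow> Vector_Spaces.linear sh sg (\<lambda>v. f (vs[i := v])))}"

definition component :: "nat \<Rightarrow> ('h list \<Rightarrow> 'g::ab_group_add) \<Rightarrow> 'h list \<Rightarrow> 'g" where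
  "component n f = (\<lambda>vs. if length vs = n then f vs else 0)"

definition cochains ::
  "('k::field \<Rightarrow> 'h::ab_group_add \<Rightarrow> 'h) \<Rightarrow> ('k \<Rightarrow> 'g::ab_group_add \<Rightarrow> 'g) \<Rightarrow> ('h list \<Rightarrow> 'g) set" where
  "cochains sh sg =
     {f. f [] = 0 \<and> (\<forall>n\<ge>1. component n f \<in> hom_tensor sh sg n) \<and> finite {n. component n f \<noteq> 0}}"

definition cochain_deg ::
  "('k::field \<Rightarrow> 'h::ab_group_add \<Rightarrow> 'h) \<Rightarrow> ('k \<Rightarrow> 'g::ab_group_add \<Rightarrow> 'g) \<Rightarrow> int \<Rightarrow> ('h list \<Rightarrow> 'g) set" where
  "cochain_deg sh sg p = (if p \<ge> 1 then hom_tensor sh sg (nat p) else {0})"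

definition cochain_scale ::
  "('k::field \<Rightarrow> 'g::ab_group_add \<Rightarrow> 'g) \<Rightarrow> 'k \<Rightarrow> ('h list \<Rightarrow> 'g) \<Rightarrow> 'h list \<Rightarrow> 'g" where
  "cochain_scale sg c f = (\<lambda>vs. sg c (f vs))"

text \<open>The identification of \<open>Hom(\<hh>, \<gg>)\<close> with the cochains of degree 1.\<close>

definition cochain_of_map :: "('h \<Rightarrow> 'g::ab_group_add) \<Rightarrow> 'h list \<Rightarrow> 'g" where
  "cochain_of_map T = (\<lambda>vs. if length vs = 1 then T (hd vs) else 0)"

section \<open>Differential and bracket\<close>

text \<open>Below, \<open>v i\<close> is the \<open>i\<close>-th argument counted from 1.\<close>

definition hom_d ::
  "('k::field \<Rightarrow> 'g::ab_group_add \<Rightarrow> 'g) \<Rightarrow> ('h \<Rightarrow> 'h \<Rightarrow> 'h) \<Rightarrow> nat \<Rightarrow> ('h list \<Rightarrow> 'g) \<Rightarrow> 'h list \<Rightarrow> 'g" where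
  "hom_d sg brh n f = (\<lambda>vs. if length vs = n + 1 then
     (let v = (\<lambda>i. vs ! (i - 1)) in
      \<Sum>(i, j) | 1 \<le> i \<and> i < j \<and> j \<le> n + 1.
        sg ((-1) ^ (n - 1 + i))
           (f (map v ([1..<i] @ [i+1..<j]) @ [brh (v i) (v j)] @ map v [j+1..<n+2])))
     else 0)"

definition cochain_d ::
  "('k::field \<Rightarrow> 'g::ab_group_add \<Rightarrow> 'g) \<Rightarrow> ('h \<Rightarrow> 'h \<Rightarrow> 'h) \<Rightarrow> ('h list \<Rightarrow> 'g) \<Rightarrow> 'h list \<Rightarrow> 'g" where
  "cochain_d sg brh f = (\<lambda>vs. hom_d sg brh (length vs - 1) (component (length vs - 1) f) vs)"

definition shuffle_perms :: "nat \<Rightarrow> nat \<Rightarrow> (nat \<Rightarrow> nat) set" where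
  "shuffle_perms i j = {\<sigma>. \<sigma> permutes {1..i+j} \<and> strict_mono_on {1..i} \<sigma> \<and> strict_mono_on {i+1..i+j} \<sigma>}"

definition hom_bracket ::
  "('k::field \<Rightarrow> 'g::ab_group_add \<Rightarrow> 'g) \<Rightarrow> ('g \<Rightarrow> 'g \<Rightarrow> 'g) \<Rightarrow> ('g \<Rightarrow> 'h \<Rightarrow> 'h) \<Rightarrow> nat \<Rightarrow> nat \<Rightarrow>
   ('h list \<Rightarrow> 'g) \<Rightarrow> ('h list \<Rightarrow> 'g) \<Rightarrow> 'h list \<Rightarrow> 'g" where
  "hom_bracket sg brg \<rho> m n \<theta> \<phi> = (\<lambda>vs. if length vs = m + n then
     (let v = (\<lambda>i. vs ! (i - 1)) in
      (\<Sum>k=1..m. \<Sum>\<sigma>\<in>shuffle_perms (k-1) n.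
         sg ((-1) ^ ((k-1) * n + 1) * of_int (sign \<sigma>))
            (\<theta> (map (\<lambda>i. v (\<sigma> i)) [1..<k]
                @ [\<rho> (\<phi> (map (\<lambda>i. v (\<sigma> i)) [k..<k+n])) (v (k+n))]
                @ map v [k+n+1..<m+n+1])))
      + (\<Sum>\<sigma>\<in>shuffle_perms m n.
         sg ((-1) ^ (m * n + 1) * of_int (sign \<sigma>))
            (brg (\<theta> (map (\<lambda>i. v (\<sigma> i)) [1..<m+1]))
                 (\<phi> (map (\<lambda>i. v (\<sigma> i)) [m+1..<m+n+1]))))
      + (\<Sum>k=1..n. \<Sum>\<sigma>\<in>shuffle_perms (k-1) m.
         sg ((-1) ^ (m * (k+n-1)) * of_int (sign \<sigma>))
            (\<phi> (map (\<lambda>i. v (\<sigma> i)) [1..<k]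
                @ [\<rho> (\<theta> (map (\<lambda>i. v (\<sigma> i)) [k..<k+m])) (v (k+m))]
                @ map v [k+m+1..<m+n+1]))))
     else 0)"

text \<open>The bilinear extension of \<open>hom_bracket\<close> to the direct sum.\<close>

definition cochain_bracket ::
  "('k::field \<Rightarrow> 'g::ab_group_add \<Rightarrow> 'g) \<Rightarrow> ('g \<Rightarrow> 'g \<Rightarrow> 'g) \<Rightarrow> ('g \<Rightarrow> 'h \<Rightarrow> 'h) \<Rightarrow>
   ('h list \<Rightarrow> 'g) \<Rightarrow> ('h list \<Rightarrow> 'g) \<Rightarrow> 'h list \<Rightarrow> 'g" where
  "cochain_bracket sg brg \<rho> \<theta> \<phi> =
     (\<lambda>vs. \<Sum>m = 1..<length vs.
        hom_bracket sg brg \<rho> m (length vs - m) (component m \<theta>) (component (length vs - m) \<phi>) vs)"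

lemma component_hom_tensor:
  assumes "f \<in> hom_tensor sh sg n"
  shows "component m f = (if m = n then f else 0)"
  using assms by (auto simp: component_def hom_tensor_def fun_eq_iff)

lemma hom_tensor_zero_arg:
  assumes "f \<in> hom_tensor sh sg n" "0 \<in> set vs"
  shows "f vs = 0"
proof (cases "length vs = n")
  case True
  obtain i where i: "i < length vs" "vs ! i = 0" using assms(2) by (auto simp: in_set_conv_nth)
  then interpret l: Vector_Spaces.linear sh sg "\<lambda>v. f (vs[i := v])"
    using assms(1) True by (auto simp: hom_tensor_def)
  show ?thesis using l.zero i by (metis list_update_id)
qed (use assms in \<open>auto simp: hom_tensor_def\<close>)

lemma cochain_d_homogeneous:
  assumes "f \<in> hom_tensor sh sg n" "n \<ge> 1" "vector_space sg"
  shows "cochain_d sg brh f = hom_d sg brh n f"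
proof
  interpret vector_space sg by fact
  show "cochain_d sg brh f vs = hom_d sg brh n f vs" for vs
    using assms(2)
    by (auto simp: cochain_d_def hom_d_def component_hom_tensor[OF assms(1)] Let_def
        intro!: sum.neutral)
qed

lemma (in coherent_action) cochain_bracket_homogeneous:
  assumes t: "\<theta> \<in> hom_tensor sh sg m" and p: "\<phi> \<in> hom_tensor sh sg n" and "m \<ge> 1" "n \<ge> 1"
  shows "cochain_bracket sg brg \<rho> \<theta> \<phi> = hom_bracket sg brg \<rho> m n \<theta> \<phi>"
proof
  fix vs
  have rho0: "\<rho> 0 u = 0" for u
  proof -
    interpret l: Vector_Spaces.linear sg "\<lambda>c D u. sh c (D u)" \<rho> by (rule rho_linear)
    show ?thesis using l.zero by (simp add: fun_eq_iff)
  qed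
  have br0: "brg 0 y = 0" "brg y 0 = 0" for y
  proof -
    interpret l: Vector_Spaces.linear sg sg "\<lambda>x. brg x y" by (rule g.linear_left)
    interpret r: Vector_Spaces.linear sg sg "brg y" by (rule g.linear_right)
    show "brg 0 y = 0" "brg y 0 = 0" using l.zero r.zero by auto
  qed
  have z1: "hom_bracket sg brg \<rho> a b 0 \<phi> vs = 0" for a b vs
    by (auto simp: hom_bracket_def Let_def br0 rho0 hom_tensor_zero_arg[OF p])
  have z2: "hom_bracket sg brg \<rho> a b \<theta> 0 vs = 0" for a b vs
    by (auto simp: hom_bracket_def Let_def br0 rho0 hom_tensor_zero_arg[OF t])
  have z3: "hom_bracket sg brg \<rho> a b 0 0 vs = 0" for a b vs
    by (auto simp: hom_bracket_def Let_def br0)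
  have "cochain_bracket sg brg \<rho> \<theta> \<phi> vs =
    (\<Sum>a = 1..<length vs. if a = m \<and> length vs = m + n then hom_bracket sg brg \<rho> m n \<theta> \<phi> vs else 0)"
    unfolding cochain_bracket_def
    by (rule sum.cong) (auto simp: component_hom_tensor[OF t] component_hom_tensor[OF p] z1 z2 z3)
  also have "\<dots> = hom_bracket sg brg \<rho> m n \<theta> \<phi> vs"
  proof (cases "length vs = m + n")
    case True
    then show ?thesis using assms(3,4) by simp
  next
    case False
    then show ?thesis by (simp add: hom_bracket_def)
  qed
  finally show "cochain_bracket sg brg \<rho> \<theta> \<phi> vs = hom_bracket sg brg \<rho> m n \<theta> \<phi> vs" .
qed

end

theory Submission
  imports Defs
begin

text \<open>
  Give the letters from \<open>\<hh>\<close> odd degree and consider the tensor space \<open>T(\<hh>)\<close> with the unshuffle coproduct,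
  which is coassociative and graded cocommutative (\<open>unshuffle_assoc\<close>, \<open>unshuffle_commute\<close>). A cochain \<open>\<phi>\<close> of
  degree \<open>n\<close> defines a map \<open>D\<^sub>\<phi>\<close> on words by \<open>D\<^sub>\<phi>(w v) = D\<^sub>\<phi>(w) v + \<Sum> w'' (\<rho>(\<phi>(w')) v)\<close>, where \<open>w' \<otimes> w''\<close> runs
  through the coproduct of \<open>w\<close>. Three facts carry the proof:

  \<^item> \<open>D\<^sub>\<phi>\<close> is a coderivation (\<open>coderiv_unshuffle\<close>), so composition with it is a derivation of the convolution
    bracket \<open>[\<theta>, \<phi>]\<close> of cochains, which is itself a graded Lie bracket (\<open>conv_jacobi\<close>);
  \<^item> the graded commutator of \<open>D\<^sub>\<theta>\<close> and \<open>D\<^sub>\<phi>\<close> is the coderivation of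
    \<open>\<theta> \<circ> D\<^sub>\<phi> - (-1)\<^sup>m\<^sup>n \<phi> \<circ> D\<^sub>\<theta> + [\<theta>, \<phi>]\<close> (\<open>coderiv_commutator\<close>);
  \<^item> the bracket of the theorem is the negative of the latter expression (\<open>hom_bracket_eq\<close>).

  In other words the cochains form a graded post-Lie algebra and the bracket is, up to a global sign, its
  sub-adjacent Lie bracket; the graded Jacobi identity follows formally (\<open>subadj_jacobi\<close>).

  The differential has the same shape. Let \<open>\<delta>\<close> be the coderivation obtained by letting single letters act
  through the adjoint action of \<open>\<hh>\<close> in place of \<open>\<rho> \<circ> \<phi>\<close>. Then \<open>d f = (-1)\<^sup>n f \<circ> \<delta>\<close> in degree \<open>n\<close> (\<open>hom_d_eq\<close>), and
  the formula for commutators applies again. It gives \<open>\<delta> \<circ> \<delta> = 0\<close> by the Jacobi identity of \<open>\<hh>\<close>. It also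
  shows that the commutator of \<open>D\<^sub>\<phi>\<close> and \<open>\<delta>\<close> is the coderivation of \<open>\<phi> \<circ> \<delta>\<close> alone, because coherence makes every
  \<open>\<rho>(x)\<close> map into the centre of \<open>\<hh>\<close> and vanish on brackets. This is the Leibniz rule.

  The Maurer-Cartan equation for \<open>T\<close>, evaluated at \<open>(u, v)\<close>, reads \<open>[T u, T v] - T(\<rho>(T u) v) - T [u, v] = 0\<close>.

  Words are read from right to left in all auxiliary constructions, so that appending a last letter is the
  list constructor and every identity about coproducts is an induction on lists.
\<close>

section \<open>The unshuffle coproduct\<close>

text \<open>The sign \<open>(-1)\<^sup>n\<close> as an operation on a bare abelian group, so that the combinatorics of words needs
  no scalars.\<close>

definition psgn :: "nat \<Rightarrow> 'x::ab_group_add \<Rightarrow> 'x" where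
  "psgn n x = (if even n then x else - x)"

lemma psgn_simps [simp]:
  "psgn n 0 = 0" "psgn 0 x = x" "psgn n (psgn n x) = x"
  by (auto simp: psgn_def)

lemma psgn_add: "psgn n (x + y) = psgn n x + psgn n y"
  by (simp add: psgn_def)

lemma psgn_minus: "psgn n (- x) = - psgn n x"
  by (simp add: psgn_def)

lemma psgn_apply: "psgn n f w = psgn n (f w)"
  by (simp add: psgn_def)

text \<open>The value of \<open>F\<close> on the graded unshuffle coproduct of a word whose letters all have odd degree: the
  signed sum of \<open>F a b\<close> over all ways of splitting the word into two subwords. Words are read from
  right to left, so \<open>v # w\<close> is the word \<open>w v\<close> of the usual notation; appending \<open>v\<close> to the left factor
  moves it past the letters of \<open>b\<close>, which is the sign. Coproducts are represented by the functionals
  on them throughout, since this avoids a free vector space on words.\<close>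

primrec unshuffle :: "'a list \<Rightarrow> ('a list \<Rightarrow> 'a list \<Rightarrow> 'x::ab_group_add) \<Rightarrow> 'x" where
  "unshuffle [] F = F [] []"
| "unshuffle (v # w) F = unshuffle w (\<lambda>a b. psgn (length b) (F (v # a) b) + F a (v # b))"

lemma unshuffle_cong:
  assumes "\<And>a b. length w = length a + length b \<Longrightarrow> F a b = G a b"
  shows "unshuffle w F = unshuffle w G"
  using assms
proof (induction w arbitrary: F G)
  case (Cons v w)
  show ?case unfolding unshuffle.simps
    by (rule Cons.IH) (simp add: Cons.prems)
qed simp

lemma unshuffle_zero [simp]: "unshuffle w (\<lambda>a b. 0) = 0"
  by (induction w) auto

lemma unshuffle_add: "unshuffle w (\<lambda>a b. F a b + G a b) = unshuffle w F + unshuffle w G"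
proof (induction w arbitrary: F G)
  case (Cons v w)
  have "unshuffle (v # w) (\<lambda>a b. F a b + G a b) =
     unshuffle w (\<lambda>a b. (psgn (length b) (F (v # a) b) + F a (v # b)) + (psgn (length b) (G (v # a) b) + G a (v # b)))"
    by (auto simp: psgn_add algebra_simps intro!: unshuffle_cong)
  then show ?case by (simp only: Cons.IH unshuffle.simps)
qed simp

lemma unshuffle_hom:
  assumes "\<And>x y. h (x + y) = h x + h y"
  shows "h (unshuffle w F) = unshuffle w (\<lambda>a b. h (F a b))"
proof -
  have h0: "h 0 = 0" using assms[of 0 0] by simp
  have hm: "h (- x) = - h x" for x
    using assms[of x "- x"] h0 by (simp add: eq_neg_iff_add_eq_0 add.commute)
  have hp: "h (psgn n x) = psgn n (h x)" for n x by (simp add: psgn_def hm)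
  show ?thesis by (induction w arbitrary: F) (simp_all add: assms hp)
qed

lemma unshuffle_minus: "unshuffle w (\<lambda>a b. - F a b) = - unshuffle w F"
  by (rule unshuffle_hom[symmetric]) simp

lemma unshuffle_diff: "unshuffle w (\<lambda>a b. F a b - G a b) = unshuffle w F - unshuffle w G"
  using unshuffle_add[of w F "\<lambda>a b. - G a b"] by (simp add: unshuffle_minus)

lemma unshuffle_psgn: "unshuffle w (\<lambda>a b. psgn n (F a b)) = psgn n (unshuffle w F)"
  by (rule unshuffle_hom[symmetric]) (simp add: psgn_add)

text \<open>Graded cocommutativity of the unshuffle coproduct.\<close>

lemma unshuffle_commute: "unshuffle w F = unshuffle w (\<lambda>a b. psgn (length a * length b) (F b a))"
proof (induction w arbitrary: F)
  case (Cons v w)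
  show ?case unfolding unshuffle.simps
    by (subst Cons.IH) (auto simp: psgn_def intro!: unshuffle_cong)
qed simp

text \<open>Coassociativity of the unshuffle coproduct.\<close>

lemma unshuffle_assoc:
  "unshuffle w (\<lambda>u c. unshuffle u (\<lambda>a b. G a b c)) = unshuffle w (\<lambda>a u. unshuffle u (\<lambda>b c. G a b c))"
proof (induction w arbitrary: G)
  case (Cons v w)
  \<comment> \<open>The recursion applied to the iterated coproduct: the last letter goes to one of three factors.\<close>
  let ?G = "\<lambda>a b c. psgn (length c) (psgn (length b) (G (v # a) b c) + G a (v # b) c) + G a b (v # c)"
  have "unshuffle (v # w) (\<lambda>u c. unshuffle u (\<lambda>a b. G a b c)) = unshuffle w (\<lambda>u c. unshuffle u (\<lambda>a b. ?G a b c))"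
    by (simp add: unshuffle_add unshuffle_psgn)
  also have "\<dots> = unshuffle w (\<lambda>a u. unshuffle u (\<lambda>b c. ?G a b c))"
    by (rule Cons.IH)
  also have "\<dots> = unshuffle w (\<lambda>a u. unshuffle u (\<lambda>b c. psgn (length u) (G (v # a) b c)
      + (psgn (length c) (G a (v # b) c) + G a b (v # c))))"
    by (auto simp: psgn_def intro!: unshuffle_cong)
  also have "\<dots> = unshuffle (v # w) (\<lambda>a u. unshuffle u (\<lambda>b c. G a b c))"
    by (simp add: unshuffle_add unshuffle_psgn)
  finally show ?case .
qed simp

text \<open>The first two tensor factors of the iterated coproduct are exchanged at the cost of a Koszul sign.\<close>

lemma unshuffle_assoc_swap:
  "unshuffle w (\<lambda>c u. unshuffle u (\<lambda>a b. G a b c)) = unshuffle w (\<lambda>a u. unshuffle u (\<lambda>c b. psgn (length a * length c) (G a b c)))"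
proof -
  have "unshuffle w (\<lambda>c u. unshuffle u (\<lambda>a b. G a b c)) = unshuffle w (\<lambda>u b. unshuffle u (\<lambda>c a. G a b c))"
    by (rule unshuffle_assoc[symmetric])
  also have "\<dots> = unshuffle w (\<lambda>u b. unshuffle u (\<lambda>a c. psgn (length a * length c) (G a b c)))"
    by (subst unshuffle_commute) (rule refl)
  also have "\<dots> = unshuffle w (\<lambda>a u. unshuffle u (\<lambda>c b. psgn (length a * length c) (G a b c)))"
    by (rule unshuffle_assoc)
  finally show ?thesis .
qed

section \<open>Coderivations and their commutators\<close>

text \<open>The composite \<open>f \<circ> D\<close>, evaluated at a word, for the coderivation \<open>D\<close> of degree \<open>n\<close> with
  \<open>D(w v) = D(w) v + \<Sum> w'' (\<Phi>(w') v)\<close>, the sum being over the unshuffle coproduct \<open>w' \<otimes> w''\<close> of \<open>w\<close>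
  with \<open>w'\<close> of length \<open>n\<close>. Because \<open>\<Phi>\<close> takes its letters from the left factor, it is never moved past
  anything and the recursion carries no Koszul sign. The target of \<open>f\<close> is arbitrary; below it is \<open>\<gg>\<close>
  or the group of maps from \<open>\<hh>\<close> to itself.\<close>

primrec coderiv :: "nat \<Rightarrow> ('a list \<Rightarrow> 'a \<Rightarrow> 'a) \<Rightarrow> 'a list \<Rightarrow> ('a list \<Rightarrow> 'x::ab_group_add) \<Rightarrow> 'x" where
  "coderiv n \<Phi> [] f = 0"
| "coderiv n \<Phi> (v # w) f = coderiv n \<Phi> w (\<lambda>u. f (v # u))
     + unshuffle w (\<lambda>c a. if length c = n then f (\<Phi> c v # a) else 0)"

lemma coderiv_cong:
  assumes "\<And>u. u \<noteq> [] \<Longrightarrow> length w = length u + n \<Longrightarrow> f u = g u"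
    and "\<And>c. length c = n \<Longrightarrow> \<Phi> c = \<Psi> c"
  shows "coderiv n \<Phi> w f = coderiv n \<Psi> w g"
  using assms(1)
proof (induction w arbitrary: f g)
  case (Cons v w)
  have "coderiv n \<Phi> w (\<lambda>u. f (v # u)) = coderiv n \<Psi> w (\<lambda>u. g (v # u))"
    by (rule Cons.IH) (simp add: Cons.prems)
  moreover have "unshuffle w (\<lambda>c a. if length c = n then f (\<Phi> c v # a) else 0) =
     unshuffle w (\<lambda>c a. if length c = n then g (\<Psi> c v # a) else 0)"
    by (rule unshuffle_cong) (auto simp: assms(2) Cons.prems)
  ultimately show ?case by simp
qed simp

lemma coderiv_zero [simp]: "coderiv n \<Phi> w (\<lambda>u. 0) = 0"
  by (induction w) (auto cong: if_cong)

lemma coderiv_hom: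
  assumes "\<And>x y. h (x + y) = h x + h y"
  shows "h (coderiv n \<Phi> w f) = coderiv n \<Phi> w (\<lambda>u. h (f u))"
proof -
  have h0: "h 0 = 0" using assms[of 0 0] by simp
  show ?thesis
    by (induction w arbitrary: f) (simp_all add: assms h0 unshuffle_hom[of h, OF assms] if_distrib[of h] cong: if_cong)
qed

lemma coderiv_add: "coderiv n \<Phi> w (\<lambda>u. f u + g u) = coderiv n \<Phi> w f + coderiv n \<Phi> w g"
proof (induction w arbitrary: f g)
  case (Cons v w)
  have "unshuffle w (\<lambda>c a. if length c = n then f (\<Phi> c v # a) + g (\<Phi> c v # a) else 0) =
    unshuffle w (\<lambda>c a. (if length c = n then f (\<Phi> c v # a) else 0) + (if length c = n then g (\<Phi> c v # a) else 0))"
    by (rule unshuffle_cong) simp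
  then show ?case by (simp add: Cons.IH unshuffle_add)
qed simp

lemma coderiv_minus: "coderiv n \<Phi> w (\<lambda>u. - f u) = - coderiv n \<Phi> w f"
  by (rule coderiv_hom[symmetric]) simp

lemma coderiv_diff: "coderiv n \<Phi> w (\<lambda>u. f u - g u) = coderiv n \<Phi> w f - coderiv n \<Phi> w g"
  using coderiv_add[of n \<Phi> w f "\<lambda>u. - g u"] by (simp add: coderiv_minus)

lemma coderiv_psgn: "coderiv n \<Phi> w (\<lambda>u. psgn k (f u)) = psgn k (coderiv n \<Phi> w f)"
  by (rule coderiv_hom[symmetric]) (simp add: psgn_add)

text \<open>A coderivation of degree \<open>n\<close> shortens words by \<open>n\<close> letters.\<close>

lemma coderiv_psgn_length:
  "coderiv n \<Phi> w (\<lambda>u. psgn (length u) (f u)) = psgn (length w + n) (coderiv n \<Phi> w f)"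
proof -
  have "coderiv n \<Phi> w (\<lambda>u. psgn (length u) (f u)) = coderiv n \<Phi> w (\<lambda>u. psgn (length w + n) (f u))"
    by (rule coderiv_cong) (auto simp: psgn_def)
  then show ?thesis by (simp add: coderiv_psgn)
qed

lemma coderiv_nil_support:
  assumes "\<And>u. u \<noteq> [] \<Longrightarrow> f u = 0"
  shows "coderiv n \<Phi> w f = 0"
  by (cases w) (auto simp: assms cong: if_cong)

text \<open>The coderivation property \<open>\<Delta> \<circ> D = (D \<otimes> 1 + 1 \<otimes> D) \<circ> \<Delta>\<close>, with the Koszul sign for moving \<open>D\<close> past
  the first factor. When the last letter is peeled off, the terms in which \<open>\<Phi>\<close> acts on that letter are
  matched with the help of coassociativity if the letter lies in the first factor, and of
  coassociativity and cocommutativity if it lies in the second.\<close>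

lemma coderiv_unshuffle:
  "coderiv n \<Phi> w (\<lambda>u. unshuffle u F) =
     unshuffle w (\<lambda>a b. coderiv n \<Phi> a (\<lambda>a'. F a' b) + psgn (n * length a) (coderiv n \<Phi> b (F a)))"
proof (induction w arbitrary: F)
  case (Cons v w)
  let ?I = "\<lambda>c x. if length c = n then x else 0"
  have "unshuffle w (\<lambda>c u. ?I c (unshuffle (\<Phi> c v # u) F))
    = unshuffle w (\<lambda>c u. unshuffle u (\<lambda>a b. ?I c (psgn (length b) (F (\<Phi> c v # a) b))))
      + unshuffle w (\<lambda>c u. unshuffle u (\<lambda>a b. ?I c (F a (\<Phi> c v # b))))"
    by (simp add: unshuffle_add[symmetric]) (auto intro!: unshuffle_cong)
  also have "unshuffle w (\<lambda>c u. unshuffle u (\<lambda>a b. ?I c (psgn (length b) (F (\<Phi> c v # a) b))))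
    = unshuffle w (\<lambda>u b. unshuffle u (\<lambda>c a. ?I c (psgn (length b) (F (\<Phi> c v # a) b))))"
    by (rule unshuffle_assoc[symmetric])
  also have "\<dots> = unshuffle w (\<lambda>u b. psgn (length b) (unshuffle u (\<lambda>c a. ?I c (F (\<Phi> c v # a) b))))"
    by (auto simp flip: unshuffle_psgn intro!: unshuffle_cong)
  also have "unshuffle w (\<lambda>c u. unshuffle u (\<lambda>a b. ?I c (F a (\<Phi> c v # b))))
    = unshuffle w (\<lambda>a u. unshuffle u (\<lambda>c b. psgn (length a * length c) (?I c (F a (\<Phi> c v # b)))))"
    by (rule unshuffle_assoc_swap)
  also have "\<dots> = unshuffle w (\<lambda>a u. psgn (n * length a) (unshuffle u (\<lambda>c b. ?I c (F a (\<Phi> c v # b)))))"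
    by (auto simp: mult.commute simp flip: unshuffle_psgn intro!: unshuffle_cong)
  finally have A: "unshuffle w (\<lambda>c u. ?I c (unshuffle (\<Phi> c v # u) F)) =
      unshuffle w (\<lambda>u b. psgn (length b) (unshuffle u (\<lambda>c a. ?I c (F (\<Phi> c v # a) b)))
        + psgn (n * length u) (unshuffle b (\<lambda>c b. ?I c (F u (\<Phi> c v # b)))))"
    by (simp add: unshuffle_add)
  show ?case
    apply (simp only: coderiv.simps A)
    apply (simp only: unshuffle.simps(2) Cons.IH unshuffle_add[symmetric])
    apply (rule unshuffle_cong)
    apply (simp add: coderiv_add coderiv_psgn coderiv_psgn_length psgn_add)
    apply (auto simp: psgn_def)
    done
qed simp

definition multiadditive :: "('a::ab_group_add list \<Rightarrow> 'x::ab_group_add) \<Rightarrow> bool" where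
  "multiadditive f \<longleftrightarrow> (\<forall>a x y b. f (a @ (x + y) # b) = f (a @ x # b) + f (a @ y # b))"

lemma multiadditive_Cons: "multiadditive f \<Longrightarrow> multiadditive (\<lambda>u. f (v # u))"
  unfolding multiadditive_def by (metis append_Cons)

lemma multiadditive_head: "multiadditive f \<Longrightarrow> f ((x + y) # b) = f (x # b) + f (y # b)"
  unfolding multiadditive_def by (metis append_Nil)

lemma multiadditive_head_zero: "multiadditive f \<Longrightarrow> f (0 # b) = 0"
  using multiadditive_head[of f 0 0 b] by simp

lemma multiadditive_head_minus: "multiadditive f \<Longrightarrow> f ((- x) # b) = - f (x # b)"
  using multiadditive_head[of f x "- x" b] multiadditive_head_zero[of f b]
  by (simp add: eq_neg_iff_add_eq_0 add.commute)

lemma multiadditive_head_diff: "multiadditive f \<Longrightarrow> f ((x - y) # b) = f (x # b) - f (y # b)"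
  using multiadditive_head[of f x "- y" b] by (simp add: multiadditive_head_minus)

lemma coderiv_add_op:
  assumes "multiadditive f"
  shows "coderiv n (\<lambda>c. \<Phi> c + \<Psi> c) w f = coderiv n \<Phi> w f + coderiv n \<Psi> w f"
  using assms
proof (induction w arbitrary: f)
  case (Cons v w)
  have "unshuffle w (\<lambda>c a. if length c = n then f ((\<Phi> c + \<Psi> c) v # a) else 0) =
    unshuffle w (\<lambda>c a. (if length c = n then f (\<Phi> c v # a) else 0) + (if length c = n then f (\<Psi> c v # a) else 0))"
    by (rule unshuffle_cong) (simp add: multiadditive_head[OF Cons.prems])
  then show ?case
    by (simp only: coderiv.simps Cons.IH[OF multiadditive_Cons[OF Cons.prems]] unshuffle_add) (simp only: add_ac)
qed simp

lemma coderiv_zero_op: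
  assumes "multiadditive f" "\<And>c. length c = n \<Longrightarrow> \<Phi> c = 0"
  shows "coderiv n \<Phi> w f = 0"
  using assms(1)
proof (induction w arbitrary: f)
  case (Cons v w)
  have "unshuffle w (\<lambda>c a. if length c = n then f (\<Phi> c v # a) else 0) = unshuffle w (\<lambda>c a. 0)"
    by (rule unshuffle_cong) (simp add: multiadditive_head_zero[OF Cons.prems] assms(2))
  then show ?case by (simp add: Cons.IH[OF multiadditive_Cons[OF Cons.prems]])
qed simp

text \<open>The operation whose coderivation is the graded commutator of those of \<open>\<Theta>\<close> and \<open>\<Phi>\<close>: the sub-adjacent
  bracket of a graded post-Lie algebra, with values in the Lie algebra of all maps of letters.\<close>

definition commutator_op where
  "commutator_op m n \<Theta> \<Phi> = (\<lambda>c. coderiv n \<Phi> c \<Theta> - psgn (m * n) (coderiv m \<Theta> c \<Phi>)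
     + unshuffle c (\<lambda>b a. if length b = n \<and> length a = m then (\<lambda>v. \<Theta> a (\<Phi> b v) - \<Phi> b (\<Theta> a v)) else 0))"

text \<open>Applying both composites to \<open>w v\<close> gives, by the coderivation property, four kinds of terms besides
  the inductive one. The terms in which one operation changes \<open>v\<close> and the other changes the remaining
  word cancel in the graded commutator. There remain the terms in which one operation is applied
  inside the argument of the other, and those in which both act on \<open>v\<close> in succession; by
  cocommutativity the latter form the convolution commutator. Additivity of \<open>f\<close> in the letters
  collects these into a single letter.\<close>

lemma coderiv_commutator:
  assumes "multiadditive f"
  shows "coderiv n \<Phi> w (\<lambda>u. coderiv m \<Theta> u f) - psgn (m * n) (coderiv m \<Theta> w (\<lambda>u. coderiv n \<Phi> u f))
    = coderiv (m + n) (commutator_op m n \<Theta> \<Phi>) w f"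
  using assms
proof (induction w arbitrary: f)
  case (Cons v w)
  let ?I = "\<lambda>k c x. if length c = k then x else 0"
  note fhead = multiadditive_head[OF Cons.prems] multiadditive_head_diff[OF Cons.prems]
    multiadditive_head_minus[OF Cons.prems] multiadditive_head_zero[OF Cons.prems]
  have fpsgn: "f (psgn k x # a) = psgn k (f (x # a))" for k x a
    by (simp add: psgn_def fhead)
  \<comment> \<open>The composite at \<open>w v\<close>: the inductive term, then \<open>\<Phi>\<close> inside the argument of \<open>\<Theta>\<close>, then the two mixed kinds, then both acting on \<open>v\<close>.\<close>
  have expand: "coderiv n \<Phi> (v # w) (\<lambda>u. coderiv m \<Theta> u f) =
     coderiv n \<Phi> w (\<lambda>u. coderiv m \<Theta> u (\<lambda>u. f (v # u)))
     + unshuffle w (\<lambda>c a. coderiv n \<Phi> c (\<lambda>c'. ?I m c' (f (\<Theta> c' v # a))))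
     + psgn (m * n) (unshuffle w (\<lambda>c a. ?I m c (coderiv n \<Phi> a (\<lambda>a'. f (\<Theta> c v # a')))))
     + unshuffle w (\<lambda>c u. ?I n c (coderiv m \<Theta> u (\<lambda>a. f (\<Phi> c v # a))))
     + unshuffle w (\<lambda>t a. unshuffle t (\<lambda>c e. if length c = n \<and> length e = m then f (\<Theta> e (\<Phi> c v) # a) else 0))"
    for m n \<Theta> \<Phi>
  proof -
    have "coderiv n \<Phi> w (\<lambda>u. unshuffle u (\<lambda>c a. ?I m c (f (\<Theta> c v # a)))) =
      unshuffle w (\<lambda>c a. coderiv n \<Phi> c (\<lambda>c'. ?I m c' (f (\<Theta> c' v # a)))
        + psgn (n * length c) (coderiv n \<Phi> a (\<lambda>a'. ?I m c (f (\<Theta> c v # a')))))"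
      by (rule coderiv_unshuffle)
    also have "\<dots> = unshuffle w (\<lambda>c a. coderiv n \<Phi> c (\<lambda>c'. ?I m c' (f (\<Theta> c' v # a)))
        + psgn (m * n) (?I m c (coderiv n \<Phi> a (\<lambda>a'. f (\<Theta> c v # a')))))"
      by (rule unshuffle_cong) (simp add: mult.commute)
    finally have 1: "coderiv n \<Phi> w (\<lambda>u. unshuffle u (\<lambda>c a. ?I m c (f (\<Theta> c v # a)))) =
       unshuffle w (\<lambda>c a. coderiv n \<Phi> c (\<lambda>c'. ?I m c' (f (\<Theta> c' v # a))))
       + psgn (m * n) (unshuffle w (\<lambda>c a. ?I m c (coderiv n \<Phi> a (\<lambda>a'. f (\<Theta> c v # a')))))"
      by (simp add: unshuffle_add unshuffle_psgn)
    have "unshuffle w (\<lambda>c u. ?I n c (unshuffle u (\<lambda>e a. ?I m e (f (\<Theta> e (\<Phi> c v) # a))))) =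
      unshuffle w (\<lambda>c u. unshuffle u (\<lambda>e a. if length c = n \<and> length e = m then f (\<Theta> e (\<Phi> c v) # a) else 0))"
      by (rule unshuffle_cong) simp
    also have "\<dots> = unshuffle w (\<lambda>t a. unshuffle t (\<lambda>c e. if length c = n \<and> length e = m then f (\<Theta> e (\<Phi> c v) # a) else 0))"
      by (rule unshuffle_assoc[symmetric])
    finally have *: "unshuffle w (\<lambda>c u. ?I n c (unshuffle u (\<lambda>e a. ?I m e (f (\<Theta> e (\<Phi> c v) # a))))) =
      unshuffle w (\<lambda>t a. unshuffle t (\<lambda>c e. if length c = n \<and> length e = m then f (\<Theta> e (\<Phi> c v) # a) else 0))" .
    have 2: "unshuffle w (\<lambda>c u. ?I n c (coderiv m \<Theta> (\<Phi> c v # u) f)) =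
      unshuffle w (\<lambda>c u. ?I n c (coderiv m \<Theta> u (\<lambda>a. f (\<Phi> c v # a))))
      + unshuffle w (\<lambda>t a. unshuffle t (\<lambda>c e. if length c = n \<and> length e = m then f (\<Theta> e (\<Phi> c v) # a) else 0))"
    proof -
      have "unshuffle w (\<lambda>c u. ?I n c (coderiv m \<Theta> (\<Phi> c v # u) f)) =
        unshuffle w (\<lambda>c u. ?I n c (coderiv m \<Theta> u (\<lambda>a. f (\<Phi> c v # a)))
          + ?I n c (unshuffle u (\<lambda>e a. ?I m e (f (\<Theta> e (\<Phi> c v) # a)))))"
        by (rule unshuffle_cong) simp
      then show ?thesis using * by (simp only: unshuffle_add)
    qed
    show ?thesis using 1 2 by (simp add: coderiv_add)
  qed
  \<comment> \<open>The terms with both acting on \<open>v\<close>, in the other order, brought to the same splitting of the word.\<close>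
  have comm: "psgn (m * n) (unshuffle t (\<lambda>c e. if length c = m \<and> length e = n then f (\<Phi> e (\<Theta> c v) # a) else 0))
     = unshuffle t (\<lambda>c e. if length c = n \<and> length e = m then f (\<Phi> c (\<Theta> e v) # a) else 0)" for t a
    by (subst (2) unshuffle_commute) (auto simp flip: unshuffle_psgn intro!: unshuffle_cong)
  have c1: "coderiv n \<Phi> c (\<lambda>c'. ?I m c' (f (\<Theta> c' v # a))) = f (coderiv n \<Phi> c \<Theta> v # a)"
    if "length c = m + n" for c a m n \<Theta> \<Phi>
  proof -
    have "f (coderiv n \<Phi> c \<Theta> v # a) = coderiv n \<Phi> c (\<lambda>c'. f (\<Theta> c' v # a))"
      by (rule coderiv_hom[of "\<lambda>T. f (T v # a)"]) (simp add: fhead)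
    also have "\<dots> = coderiv n \<Phi> c (\<lambda>c'. ?I m c' (f (\<Theta> c' v # a)))"
      by (rule coderiv_cong) (use that in auto)
    finally show ?thesis ..
  qed
  have c2: "coderiv n \<Phi> c (\<lambda>c'. ?I m c' (f (\<Theta> c' v # a))) = 0"
    if "length c \<noteq> m + n" for c a m n \<Theta> \<Phi>
  proof -
    have "coderiv n \<Phi> c (\<lambda>c'. ?I m c' (f (\<Theta> c' v # a))) = coderiv n \<Phi> c (\<lambda>c'. 0)"
      by (rule coderiv_cong) (use that in auto)
    then show ?thesis by simp
  qed
  have c3: "unshuffle c (\<lambda>b a'. if length b = n \<and> length a' = m then f (\<Theta> a' (\<Phi> b v) # a) - f (\<Phi> b (\<Theta> a' v) # a) else 0)
      = unshuffle c (\<lambda>b a'. f ((if length b = n \<and> length a' = m then (\<lambda>v. \<Theta> a' (\<Phi> b v) - \<Phi> b (\<Theta> a' v)) else 0) v # a))" for c a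
    by (rule unshuffle_cong) (simp add: fhead)
  have c4: "f (unshuffle c F v # a) = unshuffle c (\<lambda>b a'. f (F b a' v # a))" for c a F
    by (rule unshuffle_hom[of "\<lambda>T. f (T v # a)"]) (simp add: fhead)
  have c5: "unshuffle t (\<lambda>c e. if length c = n \<and> length e = m then F c e else 0) = 0"
    if "length t \<noteq> m + n" for t and F :: "_ \<Rightarrow> _ \<Rightarrow> 'b"
  proof -
    have "unshuffle t (\<lambda>c e. if length c = n \<and> length e = m then F c e else 0) = unshuffle t (\<lambda>c e. 0)"
      by (rule unshuffle_cong) (use that in auto)
    then show ?thesis by simp
  qed
  \<comment> \<open>What the commutator operation contributes on the last letter, in terms of the summands of \<open>expand\<close>.\<close>
  have E: "?I (m + n) c (f (commutator_op m n \<Theta> \<Phi> c v # a)) =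
     coderiv n \<Phi> c (\<lambda>c'. ?I m c' (f (\<Theta> c' v # a))) - psgn (m * n) (coderiv m \<Theta> c (\<lambda>c'. ?I n c' (f (\<Phi> c' v # a))))
     + (unshuffle c (\<lambda>c e. if length c = n \<and> length e = m then f (\<Theta> e (\<Phi> c v) # a) else 0)
     - psgn (m * n) (unshuffle c (\<lambda>c e. if length c = m \<and> length e = n then f (\<Phi> e (\<Theta> c v) # a) else 0)))" for c a
  proof (cases "length c = m + n")
    case True
    then have T': "length c = n + m" by simp
    have "unshuffle c (\<lambda>c e. if length c = n \<and> length e = m then f (\<Theta> e (\<Phi> c v) # a) else 0)
     - psgn (m * n) (unshuffle c (\<lambda>c e. if length c = m \<and> length e = n then f (\<Phi> e (\<Theta> c v) # a) else 0))
     = unshuffle c (\<lambda>b a'. if length b = n \<and> length a' = m then f (\<Theta> a' (\<Phi> b v) # a) - f (\<Phi> b (\<Theta> a' v) # a) else 0)"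
      unfolding comm unshuffle_diff[symmetric] by (rule unshuffle_cong) simp
    then show ?thesis
      by (simp add: c1[OF True] c1[OF T'] commutator_op_def c3 c4 fhead fpsgn psgn_apply True)
  next
    case False
    then have F': "length c \<noteq> n + m" by simp
    show ?thesis unfolding comm using False by (simp add: c2[OF False] c2[OF F'] c5)
  qed
  note IH = Cons.IH[OF multiadditive_Cons[OF Cons.prems, of v]]
  show ?case
    unfolding coderiv.simps(2)[of "m + n"] IH[symmetric] E
    unfolding expand[of n \<Phi> m \<Theta>] expand[of m \<Theta> n \<Phi>] unshuffle_add unshuffle_diff unshuffle_psgn psgn_add
    by (simp add: mult.commute)
qed simp

section \<open>Multilinearity\<close>

lemma linear_unfold:
  "Vector_Spaces.linear s1 s2 f \<longleftrightarrow> vector_space s1 \<and> vector_space s2 \<and>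
     (\<forall>x y. f (x + y) = f x + f y) \<and> (\<forall>c x. f (s1 c x) = s2 c (f x))"
  by (auto simp: Vector_Spaces.linear_def module_hom_def module_hom_axioms_def
      vector_space_def module_def)

lemma linear_psgn:
  assumes "Vector_Spaces.linear s1 s2 f"
  shows "Vector_Spaces.linear s1 s2 (\<lambda>x. psgn n (f x))"
proof -
  interpret Vector_Spaces.linear s1 s2 f by fact
  show ?thesis using assms by (auto simp: linear_unfold psgn_def vs2.scale_minus_right)
qed

lemma linear_add:
  assumes "Vector_Spaces.linear s1 s2 f" "Vector_Spaces.linear s1 s2 g"
  shows "Vector_Spaces.linear s1 s2 (\<lambda>x. f x + g x)"
proof -
  interpret Vector_Spaces.linear s1 s2 f by fact
  show ?thesis using assms by (auto simp: linear_unfold vs2.scale_right_distrib)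
qed

lemma linear_const_zero:
  assumes "vector_space s1" "vector_space s2"
  shows "Vector_Spaces.linear s1 s2 (\<lambda>x. 0)"
proof -
  interpret vector_space s2 by fact
  show ?thesis using assms by (auto simp: linear_unfold)
qed

lemma linear_if:
  assumes "P \<Longrightarrow> Vector_Spaces.linear s1 s2 f" "vector_space s1" "vector_space s2"
  shows "Vector_Spaces.linear s1 s2 (\<lambda>x. if P then f x else 0)"
  using assms linear_const_zero[OF assms(2,3)] by (cases P) auto

lemma linear_comp:
  assumes "Vector_Spaces.linear s1 s2 f" "Vector_Spaces.linear s2 s3 g"
  shows "Vector_Spaces.linear s1 s3 (\<lambda>x. g (f x))"
  using assms by (auto simp: linear_unfold)

lemma linear_unshuffle:
  assumes "\<And>a b. Vector_Spaces.linear s1 s2 (\<lambda>x. F x a b)"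
  shows "Vector_Spaces.linear s1 s2 (\<lambda>x. unshuffle w (F x))"
  using assms
proof (induction w arbitrary: F)
  case (Cons v w)
  show ?case unfolding unshuffle.simps
    by (rule Cons.IH) (intro linear_add linear_psgn Cons.prems)
qed simp

lemma linear_coderiv:
  assumes "\<And>u. Vector_Spaces.linear s1 s2 (\<lambda>x. f x u)"
  shows "Vector_Spaces.linear s1 s2 (\<lambda>x. coderiv n \<Phi> w (f x))"
proof -
  have vs: "vector_space s1" "vector_space s2" using assms[of "[]"] by (auto simp: linear_unfold)
  show ?thesis using assms
  proof (induction w arbitrary: f)
    case Nil
    show ?case by (simp add: linear_const_zero vs)
  next
    case (Cons v w)
    have "Vector_Spaces.linear s1 s2 (\<lambda>x. coderiv n \<Phi> w (\<lambda>u. f x (v # u)))"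
      by (rule Cons.IH) (rule Cons.prems)
    then show ?case unfolding coderiv.simps
      by (intro linear_add linear_unshuffle linear_if vs Cons.prems)
  qed
qed

definition multilinear where
  "multilinear s1 s2 f \<longleftrightarrow> (\<forall>a b. Vector_Spaces.linear s1 s2 (\<lambda>x. f (a @ x # b)))"

lemma multilinear_Cons: "multilinear s1 s2 f \<Longrightarrow> multilinear s1 s2 (\<lambda>u. f (v # u))"
  unfolding multilinear_def
proof (intro allI)
  fix a b
  assume "\<forall>a b. Vector_Spaces.linear s1 s2 (\<lambda>x. f (a @ x # b))"
  from this[rule_format, of "v # a" b]
  show "Vector_Spaces.linear s1 s2 (\<lambda>x. f (v # a @ x # b))" by simp
qed

lemma multilinear_head: "multilinear s1 s2 f \<Longrightarrow> Vector_Spaces.linear s1 s2 (\<lambda>x. f (x # u))"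
  unfolding multilinear_def by (drule spec[of _ "[]"]) simp

lemma multilinear_vs: "multilinear s1 s2 f \<Longrightarrow> vector_space s1 \<and> vector_space s2"
  unfolding multilinear_def linear_unfold by blast

lemma multilinear_multiadditive: "multilinear s1 s2 f \<Longrightarrow> multiadditive f"
  unfolding multilinear_def multiadditive_def linear_unfold by blast

lemma multilinear_add: "multilinear s1 s2 f \<Longrightarrow> multilinear s1 s2 g \<Longrightarrow> multilinear s1 s2 (\<lambda>u. f u + g u)"
  by (auto simp: multilinear_def intro!: linear_add)

lemma multilinear_psgn: "multilinear s1 s2 f \<Longrightarrow> multilinear s1 s2 (\<lambda>u. psgn n (f u))"
  by (auto simp: multilinear_def intro!: linear_psgn)

lemma multilinear_if: "multilinear s1 s2 f \<Longrightarrow> 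
  multilinear s1 s2 (\<lambda>u. if length u = n then f u else 0)"
  using multilinear_vs[of s1 s2 f] by (auto simp: multilinear_def intro!: linear_if)

lemma multilinear_unshuffle:
  assumes "\<And>b. multilinear s1 s2 (\<lambda>a. F a b)" "\<And>a. multilinear s1 s2 (F a)"
  shows "multilinear s1 s2 (\<lambda>w. unshuffle w F)"
  unfolding multilinear_def
proof (intro allI)
  fix w1 w2
  show "Vector_Spaces.linear s1 s2 (\<lambda>x. unshuffle (w1 @ x # w2) F)"
    using assms
  proof (induction w1 arbitrary: F)
    case Nil
    show ?case unfolding append_Nil unshuffle.simps
      by (intro linear_unshuffle linear_add linear_psgn multilinear_head Nil
          multilinear_head[of _ _ "\<lambda>a. F a b" for b])
  next
    case (Cons v w1)
    show ?case unfolding append_Cons unshuffle.simps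
    proof (rule Cons.IH)
      fix b
      show "multilinear s1 s2 (\<lambda>a. psgn (length b) (F (v # a) b) + F a (v # b))"
        by (intro multilinear_add multilinear_psgn multilinear_Cons[of _ _ "\<lambda>a. F a b"] Cons.prems)
    next
      fix a
      have "multilinear s1 s2 (\<lambda>b. psgn (length b) (F (v # a) b))"
        using Cons.prems(2)[of "v # a"]
        by (auto simp: multilinear_def intro!: linear_psgn)
      then show "multilinear s1 s2 (\<lambda>b. psgn (length b) (F (v # a) b) + F a (v # b))"
        by (intro multilinear_add multilinear_Cons Cons.prems)
    qed
  qed
qed

lemma multilinear_coderiv:
  assumes f: "multilinear s1 s2 f" and \<Phi>: "\<And>c. Vector_Spaces.linear s1 s1 (\<Phi> c)"
    and \<Phi>': "\<And>v. multilinear s1 s1 (\<lambda>c. \<Phi> c v)"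
  shows "multilinear s1 s2 (\<lambda>w. coderiv n \<Phi> w f)"
  unfolding multilinear_def
proof (intro allI)
  fix w1 w2
  have vs: "vector_space s1" "vector_space s2" using multilinear_vs[OF f] by auto
  show "Vector_Spaces.linear s1 s2 (\<lambda>x. coderiv n \<Phi> (w1 @ x # w2) f)"
    using f
  proof (induction w1 arbitrary: f)
    case Nil
    show ?case unfolding append_Nil coderiv.simps
      by (intro linear_add linear_coderiv linear_unshuffle linear_if vs multilinear_head[OF Nil]
          linear_comp[OF \<Phi> multilinear_head[OF Nil]])
  next
    case (Cons v w1)
    have "multilinear s1 s2 (\<lambda>w. unshuffle w (\<lambda>c a. if length c = n then f (\<Phi> c v # a) else 0))"
    proof (rule multilinear_unshuffle)
      show "multilinear s1 s2 (\<lambda>c. if length c = n then f (\<Phi> c v # a) else 0)" for a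
      proof (rule multilinear_if)
        show "multilinear s1 s2 (\<lambda>c. f (\<Phi> c v # a))"
          using \<Phi>'[of v] multilinear_head[OF Cons.prems, of a]
          by (auto simp: multilinear_def intro!: linear_comp[of s1 s1 _ s2 "\<lambda>x. f (x # a)"])
      qed
      show "multilinear s1 s2 (\<lambda>a. if length c = n then f (\<Phi> c v # a) else 0)" for c
        using multilinear_Cons[OF Cons.prems, of "\<Phi> c v"]
        by (cases "length c = n") (auto simp: multilinear_def linear_const_zero vs)
    qed
    then show ?case using Cons.IH[OF multilinear_Cons[OF Cons.prems]]
      by (auto simp: multilinear_def intro!: linear_add)
  qed
qed

lemma linear_scale:
  assumes "Vector_Spaces.linear s1 s2 f"
  shows "Vector_Spaces.linear s1 s2 (\<lambda>x. s2 c (f x))"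
proof -
  interpret Vector_Spaces.linear s1 s2 f by fact
  show ?thesis using assms by (auto simp: linear_unfold vs2.scale_right_distrib mult.commute)
qed

lemma coderiv_scale_op:
  assumes "multilinear s1 s2 f"
  shows "coderiv n (\<lambda>c v. s1 k (\<Phi> c v)) w f = s2 k (coderiv n \<Phi> w f)"
  using assms
proof (induction w arbitrary: f)
  interpret vector_space s2 using multilinear_vs[OF assms] by simp
  {
    case Nil
    show ?case by simp
  next
    case (Cons v w)
    have h: "f (s1 k x # a) = s2 k (f (x # a))" for x a
      using multilinear_head[OF Cons.prems] by (simp add: linear_unfold)
    have "unshuffle w (\<lambda>c a. if length c = n then f (s1 k (\<Phi> c v) # a) else 0)
      = s2 k (unshuffle w (\<lambda>c a. if length c = n then f (\<Phi> c v # a) else 0))"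
      by (subst unshuffle_hom[of "s2 k"]) (auto simp: scale_right_distrib h intro!: unshuffle_cong)
    then show ?case by (simp add: Cons.IH[OF multilinear_Cons[OF Cons.prems]] scale_right_distrib)
  }
qed

text \<open>Splitting the word at the varying position, instead of updating a position, fits recursion on
  lists; if the word does not have length \<open>n\<close>, the function of that letter is constantly zero and
  hence linear.\<close>

lemma hom_tensor_iff:
  assumes "vector_space sh" "vector_space sg"
  shows "f \<in> hom_tensor sh sg n \<longleftrightarrow> (\<forall>w. length w \<noteq> n \<longrightarrow> f w = 0) \<and> multilinear sh sg f"
proof (intro iffI conjI)
  assume f: "f \<in> hom_tensor sh sg n"
  then show *: "\<forall>w. length w \<noteq> n \<longrightarrow> f w = 0" by (auto simp: hom_tensor_def)
  show "multilinear sh sg f"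
    unfolding multilinear_def
  proof (intro allI)
    fix a b
    show "Vector_Spaces.linear sh sg (\<lambda>x. f (a @ x # b))"
    proof (cases "length a + length b + 1 = n")
      case True
      have "length (a @ 0 # b) = n \<longrightarrow> length a < n \<longrightarrow>
         Vector_Spaces.linear sh sg (\<lambda>v. f ((a @ 0 # b)[length a := v]))"
        using f unfolding hom_tensor_def by blast
      then show ?thesis using True by simp
    qed (use * linear_const_zero[OF assms] in auto)
  qed
next
  assume f: "(\<forall>w. length w \<noteq> n \<longrightarrow> f w = 0) \<and> multilinear sh sg f"
  have "Vector_Spaces.linear sh sg (\<lambda>v. f (vs[i := v]))" if "i < length vs" for vs i
    using f that by (auto simp: upd_conv_take_nth_drop multilinear_def)
  then show "f \<in> hom_tensor sh sg n"
    using f by (auto simp: hom_tensor_def)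
qed

lemma coderiv_support:
  assumes "\<And>u. length u \<noteq> m \<Longrightarrow> f u = 0" "length w \<noteq> m + n"
  shows "coderiv n \<Phi> w f = 0"
proof -
  have "coderiv n \<Phi> w f = coderiv n \<Phi> w (\<lambda>u. 0)"
    by (rule coderiv_cong) (use assms in auto)
  then show ?thesis by simp
qed

section \<open>The post-Lie structure on cochains\<close>

context coherent_action
begin

abbreviation "C \<equiv> hom_tensor sh sg"

text \<open>The composite \<open>\<theta> \<circ> D\<^sub>\<phi>\<close> of a cochain with the coderivation given by \<open>\<rho> \<circ> \<phi>\<close>: the post-Lie action of
  \<open>\<phi>\<close> on \<open>\<theta>\<close>.\<close>

definition act :: "nat \<Rightarrow> ('h list \<Rightarrow> 'g) \<Rightarrow> ('h list \<Rightarrow> 'g) \<Rightarrow> 'h list \<Rightarrow> 'g" where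
  "act n \<phi> \<theta> = (\<lambda>w. coderiv n (\<lambda>c. \<rho> (\<phi> c)) w \<theta>)"

text \<open>The convolution bracket. The letters are given first to \<open>\<phi>\<close> and then to \<open>\<theta>\<close>, which absorbs the
  Koszul sign \<open>(-1)\<^sup>m\<^sup>n\<close> of the usual order.\<close>

definition conv :: "('h list \<Rightarrow> 'g) \<Rightarrow> ('h list \<Rightarrow> 'g) \<Rightarrow> 'h list \<Rightarrow> 'g" where
  "conv \<theta> \<phi> = (\<lambda>w. unshuffle w (\<lambda>b a. brg (\<theta> a) (\<phi> b)))"

text \<open>The adjoint action of \<open>\<hh>\<close> composed with the projection of words onto single letters.\<close>

definition ad :: "'h list \<Rightarrow> 'h \<Rightarrow> 'h" where
  "ad c = (if length c = 1 then brh (hd c) else 0)"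

text \<open>Composition with the coderivation \<open>\<delta>\<close> of degree 1 given by the adjoint action. Up to a sign this is
  the differential; it is the coboundary of \<open>\<hh>\<close> as a Leibniz algebra with trivial coefficients.\<close>

definition leib :: "('h list \<Rightarrow> 'x::ab_group_add) \<Rightarrow> 'h list \<Rightarrow> 'x" where
  "leib f = (\<lambda>w. coderiv 1 ad w f)"

text \<open>The sub-adjacent Lie bracket of the post-Lie algebra with action \<open>act\<close> and bracket \<open>conv\<close>.\<close>

definition subadj :: "nat \<Rightarrow> nat \<Rightarrow> ('h list \<Rightarrow> 'g) \<Rightarrow> ('h list \<Rightarrow> 'g) \<Rightarrow> 'h list \<Rightarrow> 'g" where
  "subadj m n \<theta> \<phi> = act n \<phi> \<theta> - psgn (m * n) (act m \<theta> \<phi>) + conv \<theta> \<phi>"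

lemma vector_spaces: "vector_space sh" "vector_space sg" by unfold_locales

lemma C_iff: "f \<in> C n \<longleftrightarrow> (\<forall>w. length w \<noteq> n \<longrightarrow> f w = 0) \<and> multilinear sh sg f"
  by (rule hom_tensor_iff[OF vector_spaces])

lemma C_support: "f \<in> C n \<Longrightarrow> length w \<noteq> n \<Longrightarrow> f w = 0"
  by (simp add: C_iff)

lemma C_multilinear: "f \<in> C n \<Longrightarrow> multilinear sh sg f"
  by (simp add: C_iff)

lemma C_multiadditive: "f \<in> C n \<Longrightarrow> multiadditive f"
  using C_multilinear multilinear_multiadditive by blast

lemma C_psgn: "f \<in> C n \<Longrightarrow> psgn k f \<in> C n"
proof -
  assume f: "f \<in> C n"
  have "psgn k f = (\<lambda>u. psgn k (f u))" by (rule ext) (rule psgn_apply)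
  then show ?thesis using f multilinear_psgn[of sh sg f k] by (simp add: C_iff)
qed

lemma C_add: "f \<in> C n \<Longrightarrow> g \<in> C n \<Longrightarrow> f + g \<in> C n"
  using multilinear_add[of sh sg f g] by (auto simp: C_iff plus_fun_def)

lemma C_minus: "f \<in> C n \<Longrightarrow> - f \<in> C n"
  using C_psgn[of f n 1] by (simp add: psgn_def)

lemma C_diff: "f \<in> C n \<Longrightarrow> g \<in> C n \<Longrightarrow> f - g \<in> C n"
  using C_add[of f n "- g"] C_minus by simp

lemma rho_add: "\<rho> (x + y) = \<rho> x + \<rho> y"
  using rho_linear by (simp add: linear_unfold)

lemma rho_add_apply: "\<rho> (x + y) v = \<rho> x v + \<rho> y v"
  by (simp add: rho_add)

lemma rho_zero: "\<rho> 0 = 0"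
  using rho_add[of 0 0] by simp

lemma rho_scale: "\<rho> (sg c x) v = sh c (\<rho> x v)"
  using rho_linear by (simp add: linear_unfold)

lemma rho_lin: "Vector_Spaces.linear sh sh (\<rho> x)"
  using rho_derivation[of x] by (simp add: derivations_def)

lemma rho_at_zero: "\<rho> x 0 = 0"
  using rho_lin[of x] by (auto simp: linear_unfold dest: spec[of _ 0])

lemma rho_lin_left: "Vector_Spaces.linear sg sh (\<lambda>x. \<rho> x v)"
  by (simp add: linear_unfold vector_spaces rho_add_apply rho_scale)

lemma brg_add: "brg (x + y) z = brg x z + brg y z" "brg z (x + y) = brg z x + brg z y"
  using g.linear_left g.linear_right by (simp_all add: linear_unfold)

lemma brh_add: "brh (x + y) z = brh x z + brh y z" "brh z (x + y) = brh z x + brh z y"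
  using h.linear_left h.linear_right by (simp_all add: linear_unfold)

lemma brg_zero: "brg 0 z = 0" "brg z 0 = 0"
  using brg_add(1)[of 0 0 z] brg_add(2)[of z 0 0] by simp_all

lemma brh_zero: "brh 0 z = 0" "brh z 0 = 0"
  using brh_add(1)[of 0 0 z] brh_add(2)[of z 0 0] by simp_all

lemma brg_minus: "brg (- x) z = - brg x z" "brg z (- x) = - brg z x"
  using brg_add(1)[of x "- x" z] brg_add(2)[of z x "- x"]
  by (simp_all add: brg_zero eq_neg_iff_add_eq_0 add.commute)

lemma brh_minus: "brh (- x) z = - brh x z" "brh z (- x) = - brh z x"
  using brh_add(1)[of x "- x" z] brh_add(2)[of z x "- x"]
  by (simp_all add: brh_zero eq_neg_iff_add_eq_0 add.commute)

lemma brg_anti: "brg x y = - brg y x"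
proof -
  have "brg x y + brg y x = brg (x + y) (x + y)"
    unfolding brg_add by (simp add: g.alternating)
  then show ?thesis by (simp only: g.alternating eq_neg_iff_add_eq_0)
qed

lemma brh_anti: "brh x y = - brh y x"
proof -
  have "brh x y + brh y x = brh (x + y) (x + y)"
    unfolding brh_add by (simp add: h.alternating)
  then show ?thesis by (simp only: h.alternating eq_neg_iff_add_eq_0)
qed

lemma brg_leibniz: "brg x (brg y z) = brg (brg x y) z + brg y (brg x z)"
proof -
  have "brg x (brg y z) + - brg y (brg x z) + - brg (brg x y) z = 0"
    using g.jacobi[of x y z] by (metis brg_anti brg_minus(2))
  then show ?thesis by (simp add: algebra_simps)
qed

lemma brh_leibniz: "brh x (brh y z) = brh (brh x y) z + brh y (brh x z)"
proof -
  have "brh x (brh y z) + - brh y (brh x z) + - brh (brh x y) z = 0"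
    using h.jacobi[of x y z] by (metis brh_anti brh_minus(2))
  then show ?thesis by (simp add: algebra_simps)
qed

lemma act_in_C:
  assumes "\<theta> \<in> C m" "\<phi> \<in> C n"
  shows "act n \<phi> \<theta> \<in> C (m + n)"
  unfolding C_iff act_def
proof
  show "multilinear sh sg (\<lambda>w. coderiv n (\<lambda>c. \<rho> (\<phi> c)) w \<theta>)"
    using C_multilinear[OF assms(1)] rho_lin
    by (rule multilinear_coderiv)
      (use C_multilinear[OF assms(2)] in \<open>auto simp: multilinear_def intro!: linear_comp[OF _ rho_lin_left]\<close>)
qed (auto intro: coderiv_support C_support[OF assms(1)])

lemma conv_in_C:
  assumes "\<theta> \<in> C m" "\<phi> \<in> C n"
  shows "conv \<theta> \<phi> \<in> C (m + n)"
  unfolding C_iff conv_def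
proof
  show "multilinear sh sg (\<lambda>w. unshuffle w (\<lambda>b a. brg (\<theta> a) (\<phi> b)))"
    by (rule multilinear_unshuffle)
      (use assms[THEN C_multilinear] in \<open>auto simp: multilinear_def
         intro!: linear_comp[OF _ g.linear_left] linear_comp[OF _ g.linear_right]\<close>)
  have "unshuffle w (\<lambda>b a. brg (\<theta> a) (\<phi> b)) = unshuffle w (\<lambda>b a. 0)" if "length w \<noteq> m + n" for w
  proof (rule unshuffle_cong)
    fix a b :: "'h list" assume "length w = length a + length b"
    then have "length b \<noteq> m \<or> length a \<noteq> n" using that by auto
    then show "brg (\<theta> b) (\<phi> a) = 0"
      using assms[THEN C_support] by (auto simp: brg_zero)
  qed
  then show "\<forall>w. length w \<noteq> m + n \<longrightarrow> unshuffle w (\<lambda>b a. brg (\<theta> a) (\<phi> b)) = 0" by simp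
qed

lemma ad_lin: "Vector_Spaces.linear sh sh (ad c)"
  using h.linear_right by (auto simp: ad_def zero_fun_def linear_const_zero[OF vector_spaces(1) vector_spaces(1)])

lemma ad_multilinear: "multilinear sh sh (\<lambda>c. ad c v)"
proof -
  have "Vector_Spaces.linear sh sh (\<lambda>x. ad (a @ x # b) v)" for a b
    using h.linear_left[of v] linear_const_zero[OF vector_spaces(1) vector_spaces(1)]
    by (cases "a = [] \<and> b = []") (auto simp: ad_def zero_fun_def)
  then show ?thesis by (simp add: multilinear_def)
qed

lemma leib_in_C:
  assumes "f \<in> C n"
  shows "leib f \<in> C (n + 1)"
  unfolding C_iff leib_def
  using multilinear_coderiv[OF C_multilinear[OF assms] ad_lin ad_multilinear]
  by (auto intro: coderiv_support[of n] C_support[OF assms])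

lemma subadj_in_C:
  assumes "\<theta> \<in> C m" "\<phi> \<in> C n"
  shows "subadj m n \<theta> \<phi> \<in> C (m + n)"
  unfolding subadj_def using act_in_C[OF assms(2,1)]
  by (intro C_add C_diff C_psgn act_in_C conv_in_C assms) (simp add: add.commute)

lemma act_add: "act n \<phi> (\<theta> + \<theta>') = act n \<phi> \<theta> + act n \<phi> \<theta>'"
  by (rule ext) (simp add: act_def plus_fun_def coderiv_add)

lemma act_minus: "act n \<phi> (- \<theta>) = - act n \<phi> \<theta>"
  by (simp add: act_def fun_eq_iff coderiv_minus fun_Compl_def)

lemma act_diff: "act n \<phi> (\<theta> - \<theta>') = act n \<phi> \<theta> - act n \<phi> \<theta>'"
  by (rule ext) (simp add: act_def fun_diff_def coderiv_diff)

lemma act_add_op: "\<theta> \<in> C m \<Longrightarrow> act n (\<phi> + \<phi>') \<theta> = act n \<phi> \<theta> + act n \<phi>' \<theta>"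
  using coderiv_add_op[OF C_multiadditive, of \<theta> m n "\<lambda>c. \<rho> (\<phi> c)" "\<lambda>c. \<rho> (\<phi>' c)"]
  by (simp add: act_def fun_eq_iff rho_add)

lemma act_zero_op: "\<theta> \<in> C m \<Longrightarrow> act n 0 \<theta> = 0"
  by (simp add: act_def fun_eq_iff coderiv_zero_op[OF C_multiadditive] rho_zero)

lemma act_minus_op: "\<theta> \<in> C m \<Longrightarrow> act n (- \<phi>) \<theta> = - act n \<phi> \<theta>"
  using act_add_op[of \<theta> m n \<phi> "- \<phi>"] act_zero_op[of \<theta> m n]
  by (simp add: eq_neg_iff_add_eq_0 add.commute)

lemma conv_add: "conv (\<theta> + \<theta>') \<phi> = conv \<theta> \<phi> + conv \<theta>' \<phi>" "conv \<theta> (\<phi> + \<phi>') = conv \<theta> \<phi> + conv \<theta> \<phi>'"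
  by (simp_all add: conv_def fun_eq_iff brg_add unshuffle_add)

lemma conv_minus: "conv (- \<theta>) \<phi> = - conv \<theta> \<phi>" "conv \<theta> (- \<phi>) = - conv \<theta> \<phi>"
  by (simp_all add: conv_def fun_eq_iff brg_minus unshuffle_minus)

lemma conv_diff: "conv (\<theta> - \<theta>') \<phi> = conv \<theta> \<phi> - conv \<theta>' \<phi>" "conv \<theta> (\<phi> - \<phi>') = conv \<theta> \<phi> - conv \<theta> \<phi>'"
  using conv_add(1)[of \<theta> "- \<theta>'" \<phi>] conv_add(2)[of \<theta> \<phi> "- \<phi>'"] by (simp_all add: conv_minus)

text \<open>Cocommutativity turns antisymmetry of \<open>\<gg>\<close> into graded antisymmetry.\<close>

lemma conv_anti:
  assumes "\<theta> \<in> C m" "\<phi> \<in> C n"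
  shows "conv \<theta> \<phi> = - psgn (m * n) (conv \<phi> \<theta>)"
proof
  fix w
  have "conv \<theta> \<phi> w = unshuffle w (\<lambda>b a. psgn (length b * length a) (brg (\<theta> b) (\<phi> a)))"
    unfolding conv_def by (rule unshuffle_commute)
  also have "\<dots> = unshuffle w (\<lambda>b a. - psgn (m * n) (brg (\<phi> a) (\<theta> b)))"
  proof (rule unshuffle_cong)
    fix b a :: "'h list"
    show "psgn (length b * length a) (brg (\<theta> b) (\<phi> a)) = - psgn (m * n) (brg (\<phi> a) (\<theta> b))"
      using C_support[OF assms(1), of b] C_support[OF assms(2), of a] brg_anti[of "\<theta> b" "\<phi> a"]
      by (cases "length b = m \<and> length a = n") (auto simp: brg_zero psgn_minus)
  qed
  finally show "conv \<theta> \<phi> w = (- psgn (m * n) (conv \<phi> \<theta>)) w"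
    by (simp add: unshuffle_minus unshuffle_psgn psgn_apply conv_def)
qed

text \<open>All three double brackets become sums over the same iterated coproduct, by coassociativity and one
  exchange of factors; there the identity is the Jacobi identity of \<open>\<gg>\<close> term by term.\<close>

lemma conv_jacobi:
  assumes "\<theta> \<in> C m" "\<phi> \<in> C n"
  shows "conv \<theta> (conv \<phi> \<psi>) = conv (conv \<theta> \<phi>) \<psi> + psgn (m * n) (conv \<phi> (conv \<theta> \<psi>))"
proof
  fix w
  have right: "conv \<theta> (conv \<phi> \<psi>) w = unshuffle w (\<lambda>c u. unshuffle u (\<lambda>b a. brg (\<theta> a) (brg (\<phi> b) (\<psi> c))))"
    for \<theta> \<phi>
  proof -
    have "conv \<theta> (conv \<phi> \<psi>) w = unshuffle w (\<lambda>u a. unshuffle u (\<lambda>c b. brg (\<theta> a) (brg (\<phi> b) (\<psi> c))))"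
      unfolding conv_def by (simp add: unshuffle_hom[of "brg x" for x] brg_add)
    then show ?thesis by (simp only: unshuffle_assoc[of w "\<lambda>c b a. brg (\<theta> a) (brg (\<phi> b) (\<psi> c))"])
  qed
  have left: "conv (conv \<theta> \<phi>) \<psi> w = unshuffle w (\<lambda>c u. unshuffle u (\<lambda>b a. brg (brg (\<theta> a) (\<phi> b)) (\<psi> c)))"
    unfolding conv_def by (simp add: unshuffle_hom[of "\<lambda>x. brg x y" for y] brg_add)
  have swap: "unshuffle u (\<lambda>b a. brg (\<phi> a) (brg (\<theta> b) (\<psi> c)))
      = psgn (m * n) (unshuffle u (\<lambda>b a. brg (\<phi> b) (brg (\<theta> a) (\<psi> c))))" for u c
  proof -
    have "unshuffle u (\<lambda>b a. brg (\<phi> a) (brg (\<theta> b) (\<psi> c)))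
      = unshuffle u (\<lambda>b a. psgn (length b * length a) (brg (\<phi> b) (brg (\<theta> a) (\<psi> c))))"
      by (rule unshuffle_commute)
    also have "\<dots> = unshuffle u (\<lambda>b a. psgn (m * n) (brg (\<phi> b) (brg (\<theta> a) (\<psi> c))))"
    proof (rule unshuffle_cong)
      fix b a :: "'h list"
      show "psgn (length b * length a) (brg (\<phi> b) (brg (\<theta> a) (\<psi> c))) = psgn (m * n) (brg (\<phi> b) (brg (\<theta> a) (\<psi> c)))"
        using C_support[OF assms(1), of a] C_support[OF assms(2), of b]
        by (cases "length b = n \<and> length a = m") (auto simp: brg_zero mult.commute)
    qed
    finally show ?thesis by (simp add: unshuffle_psgn)
  qed
  have "conv \<theta> (conv \<phi> \<psi>) w = conv (conv \<theta> \<phi>) \<psi> w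
      + unshuffle w (\<lambda>c u. unshuffle u (\<lambda>b a. brg (\<phi> b) (brg (\<theta> a) (\<psi> c))))"
    unfolding right left by (simp add: brg_leibniz[of "\<theta> a" for a] unshuffle_add)
  also have "unshuffle w (\<lambda>c u. unshuffle u (\<lambda>b a. brg (\<phi> b) (brg (\<theta> a) (\<psi> c))))
      = psgn (m * n) (conv \<phi> (conv \<theta> \<psi>) w)"
    unfolding right swap by (simp add: unshuffle_psgn)
  finally show "conv \<theta> (conv \<phi> \<psi>) w = (conv (conv \<theta> \<phi>) \<psi> + psgn (m * n) (conv \<phi> (conv \<theta> \<psi>))) w"
    by (simp add: psgn_apply)
qed

text \<open>A coderivation acts on a convolution product as a derivation. This gives one axiom of a post-Lie
  algebra and, for \<open>\<delta>\<close>, one half of the Leibniz rule of the differential.\<close>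

lemma coderiv_conv:
  assumes "\<phi> \<in> C n"
  shows "coderiv p \<Phi> w (conv \<theta> \<phi>) =
    conv \<theta> (\<lambda>w. coderiv p \<Phi> w \<phi>) w + psgn (p * n) (conv (\<lambda>w. coderiv p \<Phi> w \<theta>) \<phi> w)"
proof -
  have "coderiv p \<Phi> w (conv \<theta> \<phi>) = unshuffle w (\<lambda>b a. coderiv p \<Phi> b (\<lambda>b'. brg (\<theta> a) (\<phi> b'))
      + psgn (p * length b) (coderiv p \<Phi> a (\<lambda>a'. brg (\<theta> a') (\<phi> b))))"
    unfolding conv_def by (rule coderiv_unshuffle)
  also have "\<dots> = unshuffle w (\<lambda>b a. brg (\<theta> a) (coderiv p \<Phi> b \<phi>)
      + psgn (p * n) (brg (coderiv p \<Phi> a \<theta>) (\<phi> b)))"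
  proof (rule unshuffle_cong)
    fix b a :: "'h list"
    show "coderiv p \<Phi> b (\<lambda>b'. brg (\<theta> a) (\<phi> b')) + psgn (p * length b) (coderiv p \<Phi> a (\<lambda>a'. brg (\<theta> a') (\<phi> b)))
       = brg (\<theta> a) (coderiv p \<Phi> b \<phi>) + psgn (p * n) (brg (coderiv p \<Phi> a \<theta>) (\<phi> b))"
      using C_support[OF assms, of b]
      by (cases "length b = n") (auto simp: coderiv_hom[of "brg x" for x] coderiv_hom[of "\<lambda>x. brg x y" for y] brg_add brg_zero)
  qed
  finally show ?thesis by (simp add: unshuffle_add unshuffle_psgn conv_def)
qed

lemma act_conv:
  assumes "\<phi> \<in> C n"
  shows "act p \<psi> (conv \<theta> \<phi>) = conv \<theta> (act p \<psi> \<phi>) + psgn (p * n) (conv (act p \<psi> \<theta>) \<phi>)"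
  using coderiv_conv[OF assms, of p] by (auto simp: act_def psgn_apply)

lemma leib_conv:
  assumes "\<phi> \<in> C n"
  shows "leib (conv \<theta> \<phi>) = conv \<theta> (leib \<phi>) + psgn n (conv (leib \<theta>) \<phi>)"
  using coderiv_conv[OF assms, of 1 ad] by (auto simp: leib_def psgn_apply)

text \<open>The other axiom of a post-Lie algebra: \<open>D\<close> takes the sub-adjacent bracket to the commutator,
  because \<open>\<rho>\<close> is a homomorphism.\<close>

lemma act_subadj:
  assumes "\<theta> \<in> C m" "\<phi> \<in> C n" "\<psi> \<in> C p"
  shows "act (m + n) (subadj m n \<theta> \<phi>) \<psi> = act n \<phi> (act m \<theta> \<psi>) - psgn (m * n) (act m \<theta> (act n \<phi> \<psi>))"
proof
  fix w
  have "\<rho> (conv \<theta> \<phi> c) = unshuffle c (\<lambda>b a. if length b = n \<and> length a = m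
      then (\<lambda>v. \<rho> (\<theta> a) (\<rho> (\<phi> b) v) - \<rho> (\<phi> b) (\<rho> (\<theta> a) v)) else 0)" for c
    unfolding conv_def unshuffle_hom[of \<rho>, OF rho_add]
    by (rule unshuffle_cong)
      (use C_support[OF assms(1)] C_support[OF assms(2)] in \<open>auto simp: brg_zero rho_zero rho_bracket rho_at_zero fun_eq_iff\<close>)
  then have "\<rho> (subadj m n \<theta> \<phi> c) = commutator_op m n (\<lambda>c. \<rho> (\<theta> c)) (\<lambda>c. \<rho> (\<phi> c)) c" for c
  proof -
    have m: "\<rho> (- x) = - \<rho> x" for x
      using rho_add[of x "- x"] by (simp add: rho_zero eq_neg_iff_add_eq_0 add.commute)
    have d: "\<rho> (x - y) = \<rho> x - \<rho> y" for x y
      using rho_add[of x "- y"] m by simp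
    have s: "\<rho> (psgn k x) = psgn k (\<rho> x)" for k x
      by (simp add: psgn_def m)
    assume "\<And>c. \<rho> (conv \<theta> \<phi> c) = unshuffle c (\<lambda>b a. if length b = n \<and> length a = m
      then (\<lambda>v. \<rho> (\<theta> a) (\<rho> (\<phi> b) v) - \<rho> (\<phi> b) (\<rho> (\<theta> a) v)) else 0)"
    then show ?thesis
      by (simp add: subadj_def commutator_op_def rho_add d s psgn_apply act_def coderiv_hom[of \<rho>, OF rho_add])
  qed
  then show "act (m + n) (subadj m n \<theta> \<phi>) \<psi> w = (act n \<phi> (act m \<theta> \<psi>) - psgn (m * n) (act m \<theta> (act n \<phi> \<psi>))) w"
    using coderiv_commutator[OF C_multiadditive[OF assms(3)], of n "\<lambda>c. \<rho> (\<phi> c)" w m "\<lambda>c. \<rho> (\<theta> c)"]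
    by (simp add: act_def psgn_apply)
qed

lemma subadj_anti:
  assumes "\<theta> \<in> C m" "\<phi> \<in> C n"
  shows "subadj m n \<theta> \<phi> = - psgn (m * n) (subadj n m \<phi> \<theta>)"
  unfolding subadj_def conv_anti[OF assms] by (auto simp: psgn_def mult.commute)

text \<open>Purely formal from the two post-Lie axioms and the graded Lie identities of the convolution
  bracket: expanding all brackets leaves an identity in an abelian group for each parity of the three
  degrees.\<close>

lemma subadj_jacobi:
  assumes "\<theta> \<in> C m" "\<phi> \<in> C n" "\<psi> \<in> C p"
  shows "subadj m (n + p) \<theta> (subadj n p \<phi> \<psi>) =
    subadj (m + n) p (subadj m n \<theta> \<phi>) \<psi> + psgn (m * n) (subadj n (m + p) \<phi> (subadj m p \<theta> \<psi>))"
proof -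
  have cj: "conv \<theta> (conv \<phi> \<psi>) = conv (conv \<theta> \<phi>) \<psi> + psgn (m * n) (conv \<phi> (conv \<theta> \<psi>))"
    by (rule conv_jacobi[OF assms(1,2)])
  have ca: "conv (act p \<psi> \<theta>) \<phi> = - psgn ((m + p) * n) (conv \<phi> (act p \<psi> \<theta>))"
    by (rule conv_anti[OF act_in_C[OF assms(1,3)] assms(2)])
  show ?thesis
    unfolding subadj_def[of m "n + p"] subadj_def[of "m + n" p] subadj_def[of n "m + p"]
      act_subadj[OF assms] act_subadj[OF assms(2,3,1)] act_subadj[OF assms(1,3,2)]
    unfolding subadj_def act_add act_diff conv_add conv_diff
    unfolding cj act_conv[OF assms(2)] act_conv[OF assms(3)] 
    by (cases "even m"; cases "even n"; cases "even p")
       (simp_all add: ca psgn_def act_minus conv_minus algebra_simps)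
qed

lemma leib_add: "leib (f + g) = leib f + leib g"
  by (rule ext) (simp add: leib_def plus_fun_def coderiv_add)

lemma leib_minus: "leib (- f) = - leib f"
  by (rule ext) (simp add: leib_def coderiv_minus fun_Compl_def)

lemma leib_diff: "leib (f - g) = leib f - leib g"
  by (rule ext) (simp add: leib_def fun_diff_def coderiv_diff)

text \<open>By coherence \<open>\<rho>(x)\<close> has its image in the centre of \<open>\<hh>\<close>.\<close>

lemma coderiv_rho_ad: "coderiv n (\<lambda>c. \<rho> (\<phi> c)) w ad = 0"
proof (cases w)
  case (Cons v w')
  have "ad (\<rho> x v # a) = 0" for x a
    by (auto simp: ad_def coherent fun_eq_iff)
  moreover have "coderiv n (\<lambda>c. \<rho> (\<phi> c)) w' (\<lambda>u. ad (v # u)) = 0"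
    by (rule coderiv_nil_support) (simp add: ad_def)
  ultimately show ?thesis using Cons by (simp cong: if_cong)
qed simp

text \<open>A derivation with image in the centre kills all brackets.\<close>

lemma brh_rho: "brh u (\<rho> x v) = 0" and rho_brh: "\<rho> x (brh u v) = 0"
proof -
  show *: "brh u (\<rho> x v) = 0" for u v
    using brh_anti[of u "\<rho> x v"] coherent by simp
  show "\<rho> x (brh u v) = 0"
    using rho_derivation[of x] coherent * by (simp add: derivations_def)
qed

text \<open>This is \<open>[D\<^sub>\<phi>, \<delta>] = D\<close> for the operation \<open>\<rho> \<circ> \<phi> \<circ> \<delta>\<close>. The general formula for the commutator has
  two further terms, in which \<open>ad\<close> meets \<open>\<rho>\<close>; both vanish for a coherent action.\<close>

lemma leib_act:
  assumes "\<theta> \<in> C m" "\<phi> \<in> C n"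
  shows "leib (act n \<phi> \<theta>) = act (n + 1) (leib \<phi>) \<theta> + psgn n (act n \<phi> (leib \<theta>))"
proof
  fix w
  have "commutator_op n 1 (\<lambda>c. \<rho> (\<phi> c)) ad = (\<lambda>c. \<rho> (leib \<phi> c))"
  proof
    fix c
    have "unshuffle c (\<lambda>b a. if length b = 1 \<and> length a = n then (\<lambda>v. \<rho> (\<phi> a) (ad b v) - ad b (\<rho> (\<phi> a) v)) else 0)
      = unshuffle c (\<lambda>b a. 0)"
      by (rule unshuffle_cong) (auto simp: ad_def rho_brh brh_rho)
    then show "commutator_op n 1 (\<lambda>c. \<rho> (\<phi> c)) ad c = \<rho> (leib \<phi> c)"
      by (simp add: commutator_op_def coderiv_rho_ad leib_def coderiv_hom[of \<rho>, OF rho_add])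
  qed
  then show "leib (act n \<phi> \<theta>) w = (act (n + 1) (leib \<phi>) \<theta> + psgn n (act n \<phi> (leib \<theta>))) w"
    using coderiv_commutator[OF C_multiadditive[OF assms(1)], of 1 ad w n "\<lambda>c. \<rho> (\<phi> c)"]
    by (simp add: act_def leib_def psgn_apply algebra_simps)
qed

lemma leib_subadj:
  assumes "\<theta> \<in> C m" "\<phi> \<in> C n"
  shows "leib (subadj m n \<theta> \<phi>) = subadj m (n + 1) \<theta> (leib \<phi>) + psgn n (subadj (m + 1) n (leib \<theta>) \<phi>)"
  unfolding subadj_def
  by (cases "even m"; cases "even n")
    (simp_all add: psgn_def leib_add leib_minus leib_diff leib_act[OF assms] leib_act[OF assms(2,1)]
      leib_conv[OF assms(2)] algebra_simps)

text \<open>The odd coderivation \<open>\<delta>\<close> satisfies \<open>2 \<delta>\<^sup>2 = [\<delta>, \<delta>]\<close>, and this is the coderivation of an operation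
  on two letters that vanishes by the Jacobi identity of \<open>\<hh>\<close>.\<close>

lemma leib_leib:
  assumes "f \<in> C n"
  shows "leib (leib f) + leib (leib f) = 0"
proof
  fix w
  have z: "commutator_op 1 1 ad ad c = 0" if len: "length c = 2" for c
  proof -
    from len have "\<exists>y x. c = [y, x]" by (cases c; cases "tl c") auto
    then obtain x y where c: "c = [y, x]" by blast
    show ?thesis
      by (simp add: c commutator_op_def ad_def psgn_def fun_eq_iff coherent brh_leibniz[of x y])
  qed
  have "coderiv 2 (commutator_op 1 1 ad ad) w f = 0"
    by (rule coderiv_zero_op[OF C_multiadditive[OF assms] z])
  then show "(leib (leib f) + leib (leib f)) w = 0 w"
    using coderiv_commutator[OF C_multiadditive[OF assms], of 1 ad w 1 ad]
    by (simp add: leib_def psgn_def numeral_2_eq_2)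
qed

end

section \<open>Sums over shuffle permutations\<close>

definition perm_sgn :: "(nat \<Rightarrow> nat) \<Rightarrow> 'x::ab_group_add \<Rightarrow> 'x" where
  "perm_sgn \<sigma> x = (if evenperm \<sigma> then x else - x)"

lemma psgn_sum: "psgn n (sum f A) = (\<Sum>x\<in>A. psgn n (f x))"
  by (simp add: psgn_def sum_negf)

lemma finite_shuffle_perms: "finite (shuffle_perms i j)"
  by (rule finite_subset[OF _ finite_permutations[of "{1..i+j}"]]) (auto simp: shuffle_perms_def)

text \<open>The cycle that sends \<open>i\<close> to \<open>i + j\<close> and lowers \<open>i + 1, \<dots>, i + j\<close> by one, as a product of
  transpositions from which its sign can be read off.\<close>

primrec insert_cycle :: "nat \<Rightarrow> nat \<Rightarrow> nat \<Rightarrow> nat" where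
  "insert_cycle i 0 = id"
| "insert_cycle i (Suc j) = Transposition.transpose (i + j) (i + Suc j) \<circ> insert_cycle i j"

lemma insert_cycle_apply: "insert_cycle i j t = (if t = i then i + j else if i < t \<and> t \<le> i + j then t - 1 else t)"
  by (induction j arbitrary: t) (auto simp: transpose_def)

lemma permutation_insert_cycle: "permutation (insert_cycle i j)"
proof (induction j)
  case (Suc j)
  then show ?case unfolding insert_cycle.simps by (intro permutation_compose permutation_swap_id)
qed (simp add: permutation_id)

lemma evenperm_insert_cycle: "evenperm (insert_cycle i j) \<longleftrightarrow> even j"
proof (induction j)
  case (Suc j)
  then show ?case unfolding insert_cycle.simps
    by (simp add: evenperm_comp permutation_insert_cycle permutation_swap_id evenperm_swap del: comp_apply)
qed (simp add: evenperm_id)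

lemma inv_insert_cycle_apply: "inv (insert_cycle i j) t = (if t = i + j then i else if i \<le> t \<and> t < i + j then t + 1 else t)"
  by (rule inv_f_eq) (auto simp: insert_cycle_apply intro: permutation_bijective[OF permutation_insert_cycle, THEN bij_is_inj])

lemma insert_cycle_permutes: "1 \<le> i \<Longrightarrow> insert_cycle i j permutes {1..i+j}"
  unfolding permutes_def bij_iff[symmetric]
  by (intro conjI permutation_bijective[OF permutation_insert_cycle]) (simp add: insert_cycle_apply)

text \<open>A largest element at the end of the second block is a fixed point, and dropping it leaves a
  shuffle.\<close>

lemma shuffle_perms_last:
  "{\<sigma> \<in> shuffle_perms i (Suc j). \<sigma> (i + Suc j) = i + Suc j} = shuffle_perms i j"
proof (intro equalityI subsetI)
  fix \<sigma> assume s: "\<sigma> \<in> {\<sigma> \<in> shuffle_perms i (Suc j). \<sigma> (i + Suc j) = i + Suc j}"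
  then have p: "\<sigma> permutes {1..i + Suc j}" and m: "strict_mono_on {1..i} \<sigma>"
    "strict_mono_on {i + 1..i + Suc j} \<sigma>" by (simp_all add: shuffle_perms_def)
  have "\<sigma> permutes {1..i + j}"
  proof (rule permutes_superset[OF p])
    fix x assume "x \<in> {1..i + Suc j} - {1..i + j}"
    then have "x = i + Suc j" by auto
    then show "\<sigma> x = x" using s by simp
  qed
  moreover have "strict_mono_on {i + 1..i + j} \<sigma>"
    by (rule strict_mono_onI, rule strict_mono_onD[OF m(2)]) auto
  ultimately show "\<sigma> \<in> shuffle_perms i j"
    using m(1) by (simp add: shuffle_perms_def)
next
  fix \<sigma> assume s: "\<sigma> \<in> shuffle_perms i j"
  then have p: "\<sigma> permutes {1..i + j}" by (simp add: shuffle_perms_def)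
  have N: "\<sigma> (i + Suc j) = i + Suc j" using p by (simp add: permutes_def)
  have le: "\<sigma> t < i + Suc j" if "t \<in> {1..i + j}" for t
    using permutes_in_image[OF p, of t] that by auto
  have "strict_mono_on {i + 1..i + Suc j} \<sigma>"
    unfolding strict_mono_on_def
  proof (intro allI impI)
    fix r t assume rt: "r \<in> {i + 1..i + Suc j} \<and> t \<in> {i + 1..i + Suc j} \<and> r < t"
    show "\<sigma> r < \<sigma> t"
    proof (cases "t = i + Suc j")
      case True
      with rt le[of r] N show ?thesis by auto
    next
      case False
      have "strict_mono_on {i + 1..i + j} \<sigma>" using s by (simp add: shuffle_perms_def)
      then show ?thesis by (rule strict_mono_onD) (use rt False in auto)
    qed
  qed
  moreover have "\<sigma> permutes {1..i + Suc j}"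
    by (rule permutes_subset[OF p]) auto
  ultimately show "\<sigma> \<in> {\<sigma> \<in> shuffle_perms i (Suc j). \<sigma> (i + Suc j) = i + Suc j}"
    using s N by (auto simp: shuffle_perms_def)
qed

text \<open>A largest element at the end of the first block becomes a fixed point once the shuffle is composed
  with the cycle that carries it across the second block.\<close>

lemma shuffle_perms_middle:
  "bij_betw (\<lambda>\<tau>. \<tau> \<circ> insert_cycle (Suc i) j) (shuffle_perms i j)
     {\<sigma> \<in> shuffle_perms (Suc i) j. \<sigma> (Suc i) = Suc i + j}"
proof (rule bij_betw_byWitness[where f' = "\<lambda>\<sigma>. \<sigma> \<circ> inv (insert_cycle (Suc i) j)"])
  have b: "bij (insert_cycle (Suc i) j)" by (rule permutation_bijective[OF permutation_insert_cycle])
  show "\<forall>\<tau>\<in>shuffle_perms i j. \<tau> \<circ> insert_cycle (Suc i) j \<circ> inv (insert_cycle (Suc i) j) = \<tau>"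
    using bij_is_surj[OF b] by (simp add: o_assoc[symmetric] surj_iff)
  show "\<forall>\<sigma>\<in>{\<sigma> \<in> shuffle_perms (Suc i) j. \<sigma> (Suc i) = Suc i + j}.
       \<sigma> \<circ> inv (insert_cycle (Suc i) j) \<circ> insert_cycle (Suc i) j = \<sigma>"
    using b by (simp add: o_assoc[symmetric] bij_is_inj)
  show "(\<lambda>\<tau>. \<tau> \<circ> insert_cycle (Suc i) j) ` shuffle_perms i j
      \<subseteq> {\<sigma> \<in> shuffle_perms (Suc i) j. \<sigma> (Suc i) = Suc i + j}"
  proof (rule image_subsetI)
    fix \<tau> assume t: "\<tau> \<in> shuffle_perms i j"
    then have p: "\<tau> permutes {1..i + j}" by (simp add: shuffle_perms_def)
    have N: "\<tau> (Suc i + j) = Suc i + j" using p by (simp add: permutes_def)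
    have le: "\<tau> t < Suc i + j" if "t \<in> {1..i + j}" for t
      using permutes_in_image[OF p, of t] that by auto
    have "\<tau> permutes {1..Suc i + j}" by (rule permutes_subset[OF p]) auto
    then have "\<tau> \<circ> insert_cycle (Suc i) j permutes {1..Suc i + j}"
      by (intro permutes_compose insert_cycle_permutes) auto
    moreover have "strict_mono_on {1..Suc i} (\<tau> \<circ> insert_cycle (Suc i) j)"
      using t le N by (auto simp: shuffle_perms_def strict_mono_on_def insert_cycle_apply)
    moreover have "strict_mono_on {Suc i + 1..Suc i + j} (\<tau> \<circ> insert_cycle (Suc i) j)"
    proof (rule strict_mono_onI)
      fix r s assume rs: "r \<in> {Suc i + 1..Suc i + j}" "s \<in> {Suc i + 1..Suc i + j}" "r < s"
      have "strict_mono_on {i + 1..i + j} \<tau>" using t by (simp add: shuffle_perms_def)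
      then have "\<tau> (r - 1) < \<tau> (s - 1)" by (rule strict_mono_onD) (use rs in auto)
      then show "(\<tau> \<circ> insert_cycle (Suc i) j) r < (\<tau> \<circ> insert_cycle (Suc i) j) s"
        using rs by (auto simp: insert_cycle_apply)
    qed
    ultimately show "\<tau> \<circ> insert_cycle (Suc i) j \<in> {\<sigma> \<in> shuffle_perms (Suc i) j. \<sigma> (Suc i) = Suc i + j}"
      using N by (simp add: shuffle_perms_def insert_cycle_apply)
  qed
  show "(\<lambda>\<sigma>. \<sigma> \<circ> inv (insert_cycle (Suc i) j)) ` {\<sigma> \<in> shuffle_perms (Suc i) j. \<sigma> (Suc i) = Suc i + j}
      \<subseteq> shuffle_perms i j"
  proof (rule image_subsetI)
    fix \<sigma> assume s: "\<sigma> \<in> {\<sigma> \<in> shuffle_perms (Suc i) j. \<sigma> (Suc i) = Suc i + j}"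
    then have "\<sigma> \<circ> inv (insert_cycle (Suc i) j) permutes {1..Suc i + j}"
      by (intro permutes_compose permutes_inv insert_cycle_permutes) (auto simp: shuffle_perms_def)
    then have "\<sigma> \<circ> inv (insert_cycle (Suc i) j) permutes {1..i + j}"
      by (rule permutes_superset) (use s in \<open>auto simp: inv_insert_cycle_apply le_Suc_eq\<close>)
    moreover have "strict_mono_on {1..i} (\<sigma> \<circ> inv (insert_cycle (Suc i) j))"
      using s by (auto simp: shuffle_perms_def strict_mono_on_def inv_insert_cycle_apply)
    moreover have "strict_mono_on {i + 1..i + j} (\<sigma> \<circ> inv (insert_cycle (Suc i) j))"
      using s by (auto simp: shuffle_perms_def strict_mono_on_def inv_insert_cycle_apply)
    ultimately show "\<sigma> \<circ> inv (insert_cycle (Suc i) j) \<in> shuffle_perms i j"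
      by (simp add: shuffle_perms_def)
  qed
qed

text \<open>A block is increasing, so the largest element can only be the last one of its block.\<close>

lemma shuffle_perms_max:
  assumes s: "\<sigma> \<in> shuffle_perms i j" and "i + j > 0"
  shows "(i > 0 \<and> \<sigma> i = i + j) \<or> (j > 0 \<and> \<sigma> (i + j) = i + j)"
proof -
  have p: "\<sigma> permutes {1..i + j}" using s by (simp add: shuffle_perms_def)
  then obtain t where t: "t \<in> {1..i + j}" "\<sigma> t = i + j"
    using permutes_image[OF p] assms(2) by (metis One_nat_def Suc_leI atLeastAtMost_iff imageE order_refl)
  have le: "\<sigma> u \<le> i + j" if "u \<in> {1..i + j}" for u
    using permutes_in_image[OF p, of u] that by auto
  have "t = i \<or> t = i + j"
  proof (rule ccontr)
    assume n: "\<not> (t = i \<or> t = i + j)"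
    show False
    proof (cases "t < i")
      case True
      have "strict_mono_on {1..i} \<sigma>" using s by (simp add: shuffle_perms_def)
      then have "\<sigma> t < \<sigma> i" by (rule strict_mono_onD) (use t True in auto)
      with le[of i] t True show False by auto
    next
      case False
      have "strict_mono_on {i + 1..i + j} \<sigma>" using s by (simp add: shuffle_perms_def)
      then have "\<sigma> t < \<sigma> (i + j)" by (rule strict_mono_onD) (use t False n in auto)
      with le[of "i + j"] t show False by auto
    qed
  qed
  then show ?thesis using t by (cases "j = 0") auto
qed

lemma evenperm_shuffle_middle:
  assumes "\<tau> \<in> shuffle_perms i j"
  shows "evenperm (\<tau> \<circ> insert_cycle (Suc i) j) \<longleftrightarrow> (evenperm \<tau> \<longleftrightarrow> even j)"
proof -
  have "permutation \<tau>"
    using assms by (intro permutes_imp_permutation[of "{1..i + j}"]) (auto simp: shuffle_perms_def)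
  then show ?thesis by (simp add: evenperm_comp permutation_insert_cycle evenperm_insert_cycle)
qed

definition shuffle_sum :: "nat \<Rightarrow> nat \<Rightarrow> 'a list \<Rightarrow> ('a list \<Rightarrow> 'a list \<Rightarrow> 'x::ab_group_add) \<Rightarrow> 'x" where
  "shuffle_sum i j w F = (\<Sum>\<sigma>\<in>shuffle_perms i j.
     perm_sgn \<sigma> (F (map (\<lambda>t. w ! (\<sigma> t - 1)) [1..<i+1]) (map (\<lambda>t. w ! (\<sigma> t - 1)) [i+1..<i+j+1])))"

lemma shuffle_sum_middle:
  assumes "length w = i + j"
  shows "(\<Sum>\<sigma> | \<sigma> \<in> shuffle_perms (Suc i) j \<and> \<sigma> (Suc i) = Suc i + j.
     perm_sgn \<sigma> (F (map (\<lambda>t. (w @ [v]) ! (\<sigma> t - 1)) [1..<Suc i+1]) (map (\<lambda>t. (w @ [v]) ! (\<sigma> t - 1)) [Suc i+1..<Suc i+j+1])))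
    = psgn j (shuffle_sum i j w (\<lambda>a b. F (a @ [v]) b))" (is "?L = _")
proof -
  have "?L = (\<Sum>\<tau>\<in>shuffle_perms i j. let \<sigma> = \<tau> \<circ> insert_cycle (Suc i) j in
     perm_sgn \<sigma> (F (map (\<lambda>t. (w @ [v]) ! (\<sigma> t - 1)) [1..<Suc i+1]) (map (\<lambda>t. (w @ [v]) ! (\<sigma> t - 1)) [Suc i+1..<Suc i+j+1])))"
    unfolding Let_def by (rule sum.reindex_bij_betw[OF shuffle_perms_middle, symmetric])
  also have "\<dots> = (\<Sum>\<tau>\<in>shuffle_perms i j. psgn j (perm_sgn \<tau>
     (F (map (\<lambda>t. w ! (\<tau> t - 1)) [1..<i+1] @ [v]) (map (\<lambda>t. w ! (\<tau> t - 1)) [i+1..<i+j+1]))))"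
  proof (rule sum.cong[OF refl])
    fix \<tau> assume t: "\<tau> \<in> shuffle_perms i j"
    then have p: "\<tau> permutes {1..i + j}" by (simp add: shuffle_perms_def)
    have N: "\<tau> (Suc i + j) = Suc i + j" using p by (simp add: permutes_def)
    have le: "\<tau> t - 1 < length w" if "t \<in> {1..i + j}" for t
      using permutes_in_image[OF p, of t] that assms by auto
    let ?s = "\<tau> \<circ> insert_cycle (Suc i) j"
    have 1: "map (\<lambda>t. (w @ [v]) ! (?s t - 1)) [1..<Suc i+1] = map (\<lambda>t. w ! (\<tau> t - 1)) [1..<i+1] @ [v]"
      using le N by (auto simp: insert_cycle_apply nth_append assms)
    have 2: "map (\<lambda>t. (w @ [v]) ! (?s t - 1)) [Suc i+1..<Suc i+j+1] = map (\<lambda>t. w ! (\<tau> t - 1)) [i+1..<i+j+1]"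
      using le by (intro nth_equalityI) (auto simp: insert_cycle_apply nth_append simp del: upt_Suc)
    show "(let \<sigma> = ?s in
     perm_sgn \<sigma> (F (map (\<lambda>t. (w @ [v]) ! (\<sigma> t - 1)) [1..<Suc i+1]) (map (\<lambda>t. (w @ [v]) ! (\<sigma> t - 1)) [Suc i+1..<Suc i+j+1])))
      = psgn j (perm_sgn \<tau>
     (F (map (\<lambda>t. w ! (\<tau> t - 1)) [1..<i+1] @ [v]) (map (\<lambda>t. w ! (\<tau> t - 1)) [i+1..<i+j+1])))"
      unfolding Let_def 1 2 using evenperm_shuffle_middle[OF t]
      by (auto simp: perm_sgn_def psgn_def)
  qed
  finally show ?thesis by (simp only: psgn_sum shuffle_sum_def)
qed

lemma shuffle_sum_last:
  assumes "length w = i + j"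
  shows "(\<Sum>\<sigma> | \<sigma> \<in> shuffle_perms i (Suc j) \<and> \<sigma> (i + Suc j) = i + Suc j.
     perm_sgn \<sigma> (F (map (\<lambda>t. (w @ [v]) ! (\<sigma> t - 1)) [1..<i+1]) (map (\<lambda>t. (w @ [v]) ! (\<sigma> t - 1)) [i+1..<i+Suc j+1])))
    = shuffle_sum i j w (\<lambda>a b. F a (b @ [v]))" (is "?L = _")
  unfolding shuffle_sum_def shuffle_perms_last
proof (rule sum.cong[OF refl])
  fix \<tau> assume t: "\<tau> \<in> shuffle_perms i j"
  then have p: "\<tau> permutes {1..i + j}" by (simp add: shuffle_perms_def)
  have N: "\<tau> (Suc (i + j)) = Suc (i + j)" using p by (simp add: permutes_def)
  have le: "\<tau> t - 1 < length w" if "t \<in> {1..i + j}" for t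
    using permutes_in_image[OF p, of t] that assms by auto
  have 1: "map (\<lambda>t. (w @ [v]) ! (\<tau> t - 1)) [1..<i+1] = map (\<lambda>t. w ! (\<tau> t - 1)) [1..<i+1]"
    using le by (auto simp: nth_append)
  have 2: "map (\<lambda>t. (w @ [v]) ! (\<tau> t - 1)) [i+1..<i+Suc j+1] = map (\<lambda>t. w ! (\<tau> t - 1)) [i+1..<i+j+1] @ [v]"
    using le N by (auto simp: nth_append assms)
  show "perm_sgn \<tau> (F (map (\<lambda>t. (w @ [v]) ! (\<tau> t - 1)) [1..<i+1]) (map (\<lambda>t. (w @ [v]) ! (\<tau> t - 1)) [i+1..<i+Suc j+1]))
    = perm_sgn \<tau> (F (map (\<lambda>t. w ! (\<tau> t - 1)) [1..<i+1]) (map (\<lambda>t. w ! (\<tau> t - 1)) [i+1..<i+j+1] @ [v]))"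
    by (simp only: 1 2)
qed

text \<open>The two possible places of the largest element under a shuffle correspond to the two summands in
  the recursion for the coproduct: the last letter goes to the second or to the first subword, in the
  latter case with the sign of the cycle that moves it across the second block.\<close>

lemma shuffle_sum_unshuffle:
  assumes "length w = i + j"
  shows "shuffle_sum i j w F = unshuffle (rev w) (\<lambda>a b. if length a = i then F (rev a) (rev b) else 0)"
  using assms
proof (induction w arbitrary: i j F rule: rev_induct)
  case Nil
  have "shuffle_perms 0 0 = {id}" by (simp add: shuffle_perms_def strict_mono_on_def)
  then show ?case using Nil by (simp add: shuffle_sum_def perm_sgn_def)
next
  case (snoc v w)
  let ?f = "\<lambda>\<sigma>. perm_sgn \<sigma> (F (map (\<lambda>t. (w @ [v]) ! (\<sigma> t - 1)) [1..<i+1]) (map (\<lambda>t. (w @ [v]) ! (\<sigma> t - 1)) [i+1..<i+j+1]))"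
  let ?B = "{\<sigma>. \<sigma> \<in> shuffle_perms i j \<and> i > 0 \<and> \<sigma> i = i + j}"
  let ?A = "{\<sigma>. \<sigma> \<in> shuffle_perms i j \<and> j > 0 \<and> \<sigma> (i + j) = i + j}"
  have inj: "i = i + j" if "\<sigma> \<in> shuffle_perms i j" "\<sigma> i = i + j" "\<sigma> (i + j) = i + j" for \<sigma>
  proof -
    have "inj \<sigma>" using that(1) by (auto simp: shuffle_perms_def intro: permutes_inj)
    then show ?thesis by (rule injD) (simp only: that)
  qed
  have "0 < i + j" using snoc.prems by (cases "i + j") auto
  then have "shuffle_perms i j = ?B \<union> ?A"
    using shuffle_perms_max[of _ i j] by blast
  then have "shuffle_sum i j (w @ [v]) F = sum ?f (?B \<union> ?A)"
    unfolding shuffle_sum_def by (rule sum.cong) (rule refl)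
  also have "\<dots> = sum ?f ?B + sum ?f ?A"
    by (rule sum.union_disjoint)
      (use inj in \<open>auto intro: finite_subset[OF _ finite_shuffle_perms[of i j]]\<close>)
  also have "sum ?f ?B = unshuffle (rev w) (\<lambda>a b. psgn (length b) (if Suc (length a) = i then F (rev a @ [v]) (rev b) else 0))"
  proof (cases i)
    case (Suc i')
    then have l: "length w = i' + j" using snoc.prems by simp
    have "sum ?f ?B = psgn j (shuffle_sum i' j w (\<lambda>a b. F (a @ [v]) b))"
      using shuffle_sum_middle[OF l] by (simp add: Suc del: upt_Suc)
    also have "\<dots> = unshuffle (rev w) (\<lambda>a b. psgn (length b) (if Suc (length a) = i then F (rev a @ [v]) (rev b) else 0))"
      unfolding snoc.IH[OF l] unshuffle_psgn[symmetric] by (rule unshuffle_cong) (use l Suc in auto)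
    finally show ?thesis .
  qed simp
  also have "sum ?f ?A = unshuffle (rev w) (\<lambda>a b. if length a = i then F (rev a) (rev b @ [v]) else 0)"
  proof (cases j)
    case 0
    have "unshuffle (rev w) (\<lambda>a b. if length a = i then F (rev a) (rev b @ [v]) else 0) = unshuffle (rev w) (\<lambda>a b. 0)"
      by (rule unshuffle_cong) (use 0 snoc.prems in auto)
    then show ?thesis using 0 by simp
  next
    case (Suc j')
    then have l: "length w = i + j'" using snoc.prems by simp
    show ?thesis
      using shuffle_sum_last[OF l, of F v] by (simp add: Suc snoc.IH[OF l] del: upt_Suc)
  qed
  finally show ?case by (simp add: unshuffle_add cong: if_cong)
qed

text \<open>The recursion for a coderivation solved: one summand for each letter acted upon.\<close>

lemma coderiv_explicit:
  "coderiv n \<Phi> w f = (\<Sum>p<length w. unshuffle (drop (Suc p) w)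
      (\<lambda>c a. if length c = n then f (take p w @ \<Phi> c (w ! p) # a) else 0))"
proof (induction w arbitrary: f)
  case (Cons v w)
  show ?case by (simp add: Cons.IH sum.lessThan_Suc_shift add.commute del: sum.lessThan_Suc cong: if_cong)
qed simp

lemma unshuffle_length_zero:
  assumes "length w < n"
  shows "unshuffle w (\<lambda>c a. if length c = n then F c a else 0) = 0"
proof -
  have "unshuffle w (\<lambda>c a. if length c = n then F c a else 0) = unshuffle w (\<lambda>c a. 0)"
    by (rule unshuffle_cong) (use assms in auto)
  then show ?thesis by simp
qed

text \<open>The explicit formula in terms of the word \<open>vs\<close> read from left to right. The letter acted upon is
  the one with number \<open>k + n\<close>, counted from 1; letters with number at most \<open>n\<close> have too few
  predecessors.\<close>

lemma coderiv_rev: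
  assumes "length vs = m + n"
  shows "coderiv n \<Phi> (rev vs) f = (\<Sum>k=1..m. unshuffle (rev (take (k+n-1) vs))
     (\<lambda>c a. if length c = n then f (rev (drop (k+n) vs) @ \<Phi> c (vs ! (k+n-1)) # a) else 0))"
proof -
  let ?g = "\<lambda>p. unshuffle (drop (Suc p) (rev vs))
      (\<lambda>c a. if length c = n then f (take p (rev vs) @ \<Phi> c (rev vs ! p) # a) else 0)"
  have "coderiv n \<Phi> (rev vs) f = (\<Sum>p<m+n. ?g p)"
    unfolding coderiv_explicit by (simp add: assms)
  also have "\<dots> = (\<Sum>p<m. ?g p)"
    by (rule sum.mono_neutral_right) (auto simp: assms intro!: unshuffle_length_zero)
  also have "\<dots> = (\<Sum>k=1..m. ?g (m - k))"
    by (rule sum.reindex_bij_witness[of _ "\<lambda>k. m - k" "\<lambda>p. m - p"]) (auto cong: if_cong)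
  also have "\<dots> = (\<Sum>k=1..m. unshuffle (rev (take (k+n-1) vs))
     (\<lambda>c a. if length c = n then f (rev (drop (k+n) vs) @ \<Phi> c (vs ! (k+n-1)) # a) else 0))"
    by (rule sum.cong) (auto simp: assms drop_rev take_rev rev_nth Suc_diff_le add.commute cong: if_cong)
  finally show ?thesis .
qed

lemma map_nth_interval:
  "b \<le> length vs \<Longrightarrow> map (\<lambda>t. vs ! (t - 1)) [Suc a..<Suc b] = take (b - a) (drop a vs)"
  by (rule nth_equalityI) (auto simp del: upt_Suc)

text \<open>The first sum in the bracket of cochains, and with exchanged roles the third one. The shuffles list
  the argument of \<open>\<Phi>\<close> second, the coderivation takes it first; the sign in front is that of the
  exchange.\<close>

lemma shuffle_action_sum:
  assumes "length vs = m + n"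
  shows "(\<Sum>k=1..m. psgn ((k-1) * n) (\<Sum>\<sigma>\<in>shuffle_perms (k-1) n. perm_sgn \<sigma>
     (\<theta> (map (\<lambda>i. vs ! (\<sigma> i - 1)) [1..<k] @ [\<Phi> (map (\<lambda>i. vs ! (\<sigma> i - 1)) [k..<k+n]) (vs ! (k+n-1))]
         @ map (\<lambda>i. vs ! (i - 1)) [k+n+1..<m+n+1]))))
    = coderiv n (\<lambda>c. \<Phi> (rev c)) (rev vs) (\<lambda>w. \<theta> (rev w))"
  unfolding coderiv_rev[OF assms]
proof (rule sum.cong[OF refl])
  fix k assume k: "k \<in> {1..m}"
  let ?u = "take (k + n - 1) vs"
  let ?F = "\<lambda>a b. \<theta> (a @ \<Phi> b (vs ! (k+n-1)) # drop (k+n) vs)"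
  have lu: "length ?u = (k - 1) + n" using k assms by auto
  have rest: "map (\<lambda>i. vs ! (i - 1)) [k+n+1..<m+n+1] = drop (k+n) vs"
    using map_nth_interval[of "m+n" vs "k+n"] assms by simp
  have "(\<Sum>\<sigma>\<in>shuffle_perms (k-1) n. perm_sgn \<sigma>
     (\<theta> (map (\<lambda>i. vs ! (\<sigma> i - 1)) [1..<k] @ [\<Phi> (map (\<lambda>i. vs ! (\<sigma> i - 1)) [k..<k+n]) (vs ! (k+n-1))]
         @ map (\<lambda>i. vs ! (i - 1)) [k+n+1..<m+n+1])))
    = shuffle_sum (k-1) n ?u ?F"
    unfolding shuffle_sum_def
  proof (rule sum.cong[OF refl])
    fix \<sigma> assume "\<sigma> \<in> shuffle_perms (k-1) n"
    then have p: "\<sigma> permutes {1..k-1+n}" by (simp add: shuffle_perms_def)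
    have le: "\<sigma> t - 1 < k + n - 1" if "t \<in> {1..k-1+n}" for t
      using permutes_in_image[OF p, of t] that k by auto
    have 1: "map (\<lambda>i. vs ! (\<sigma> i - 1)) [1..<k] = map (\<lambda>t. ?u ! (\<sigma> t - 1)) [1..<k-1+1]"
      using k le by auto
    have 2: "map (\<lambda>i. vs ! (\<sigma> i - 1)) [k..<k+n] = map (\<lambda>t. ?u ! (\<sigma> t - 1)) [k-1+1..<k-1+n+1]"
      using k le by auto
    show "perm_sgn \<sigma>
     (\<theta> (map (\<lambda>i. vs ! (\<sigma> i - 1)) [1..<k] @ [\<Phi> (map (\<lambda>i. vs ! (\<sigma> i - 1)) [k..<k+n]) (vs ! (k+n-1))]
         @ map (\<lambda>i. vs ! (i - 1)) [k+n+1..<m+n+1])) = perm_sgn \<sigma> (?F (map (\<lambda>t. ?u ! (\<sigma> t - 1)) [1..<k-1+1]) (map (\<lambda>t. ?u ! (\<sigma> t - 1)) [k-1+1..<k-1+n+1]))"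
      unfolding 1 2 rest by simp
  qed
  also have "\<dots> = unshuffle (rev ?u) (\<lambda>a b. if length a = k - 1 then ?F (rev a) (rev b) else 0)"
    by (rule shuffle_sum_unshuffle[OF lu])
  also have "\<dots> = unshuffle (rev ?u) (\<lambda>c a. psgn (length c * length a) (if length a = k - 1 then ?F (rev a) (rev c) else 0))"
    by (rule unshuffle_commute)
  also have "\<dots> = unshuffle (rev ?u) (\<lambda>c a. psgn ((k - 1) * n) (if length c = n then ?F (rev a) (rev c) else 0))"
    by (rule unshuffle_cong) (use lu in \<open>auto simp: mult.commute\<close>)
  finally show "psgn ((k-1) * n) (\<Sum>\<sigma>\<in>shuffle_perms (k-1) n. perm_sgn \<sigma>
     (\<theta> (map (\<lambda>i. vs ! (\<sigma> i - 1)) [1..<k] @ [\<Phi> (map (\<lambda>i. vs ! (\<sigma> i - 1)) [k..<k+n]) (vs ! (k+n-1))]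
         @ map (\<lambda>i. vs ! (i - 1)) [k+n+1..<m+n+1]))) =
    unshuffle (rev ?u) (\<lambda>c a. if length c = n
      then \<theta> (rev (rev (drop (k+n) vs) @ \<Phi> (rev c) (vs ! (k+n-1)) # a)) else 0)"
    by (simp add: unshuffle_psgn cong: if_cong)
qed

lemma unshuffle_left_nil: "unshuffle w (\<lambda>c a. if c = [] then H a else 0) = H w"
  by (induction w arbitrary: H) (simp_all cong: if_cong)

text \<open>Moving the letter with index \<open>i\<close>, counted from 0, to the front passes \<open>i\<close> odd letters.\<close>

lemma unshuffle_left_single:
  "unshuffle (rev u) (\<lambda>c a. if length c = 1 then G (hd c) a else 0)
     = (\<Sum>i<length u. psgn i (G (u ! i) (rev (take i u @ drop (Suc i) u))))"
proof (induction u arbitrary: G rule: rev_induct)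
  case (snoc v u)
  have "unshuffle (rev (u @ [v])) (\<lambda>c a. if length c = 1 then G (hd c) a else 0) =
     unshuffle (rev u) (\<lambda>c a. (if c = [] then psgn (length a) (G v a) else 0)
        + (if length c = 1 then G (hd c) (v # a) else 0))"
    by (auto intro!: unshuffle_cong)
  also have "\<dots> = psgn (length u) (G v (rev u)) + (\<Sum>i<length u. psgn i (G (u ! i) (v # rev (take i u @ drop (Suc i) u))))"
    by (simp only: unshuffle_add unshuffle_left_nil snoc.IH[of "\<lambda>x a. G x (v # a)"] length_rev)
  finally show ?case by (simp add: nth_append add.commute)
qed simp

section \<open>The bracket and the differential in terms of coderivations\<close>

text \<open>Translates between words read from left to right and words read from right to left.\<close>

definition mirror :: "('a list \<Rightarrow> 'x) \<Rightarrow> 'a list \<Rightarrow> 'x" where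
  "mirror f = (\<lambda>w. f (rev w))"

lemma mirror_mirror [simp]: "mirror (mirror f) = f"
  by (simp add: mirror_def)

lemma mirror_add: "mirror (f + g) = mirror f + mirror g"
  by (simp add: mirror_def fun_eq_iff)

lemma mirror_minus: "mirror (- f) = - mirror f"
  by (simp add: mirror_def fun_eq_iff)

lemma mirror_psgn: "mirror (psgn n f) = psgn n (mirror f)"
  by (simp add: psgn_def mirror_minus)

lemma sum_apply: "(\<Sum>a\<in>A. f a) x = (\<Sum>a\<in>A. f a x)"
  by (induction A rule: infinite_finite_induct) auto

context coherent_action
begin

abbreviation "hom_br \<equiv> hom_bracket sg brg \<rho>"
abbreviation "hom_diff \<equiv> hom_d sg brh"
abbreviation "cscale \<equiv> cochain_scale sg"

lemma sg_power: "sg ((- 1) ^ e) x = psgn e x"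
  by (cases "even e") (auto simp: psgn_def)

lemma sg_sign: "sg ((- 1) ^ e * of_int (sign \<sigma>)) x = psgn e (perm_sgn \<sigma> x)"
  by (cases "even e") (auto simp: psgn_def perm_sgn_def sign_def)

lemma C_mirror: "f \<in> C n \<Longrightarrow> mirror f \<in> C n"
  by (auto simp: C_iff mirror_def multilinear_def)

text \<open>The first and the third sum are coderivations by \<open>shuffle_action_sum\<close>. In the middle sum the
  shuffles list the letters of \<open>\<theta>\<close> first whereas \<open>conv\<close> gives letters to \<open>\<phi>\<close> first; the exchange
  cancels \<open>(-1)\<^sup>m\<^sup>n\<close>.\<close>

lemma hom_bracket_eq:
  assumes "\<theta> \<in> C m" "\<phi> \<in> C n"
  shows "hom_br m n \<theta> \<phi> = - mirror (subadj m n (mirror \<theta>) (mirror \<phi>))"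
proof
  fix vs
  show "hom_br m n \<theta> \<phi> vs = (- mirror (subadj m n (mirror \<theta>) (mirror \<phi>))) vs"
  proof (cases "length vs = m + n")
    case False
    then show ?thesis
      using C_support[OF subadj_in_C[OF assms[THEN C_mirror]], of "rev vs"]
      by (simp add: hom_bracket_def mirror_def)
  next
    case True
    then have True': "length vs = n + m" by simp
    have odd: "psgn (e + 1) x = - psgn e x" for e and x :: 'g by (simp add: psgn_def)
    have 1: "(\<Sum>k=1..m. \<Sum>\<sigma>\<in>shuffle_perms (k-1) n.
         sg ((-1) ^ ((k-1) * n + 1) * of_int (sign \<sigma>))
            (\<theta> (map (\<lambda>i. vs ! (\<sigma> i - 1)) [1..<k]
                @ [\<rho> (\<phi> (map (\<lambda>i. vs ! (\<sigma> i - 1)) [k..<k+n])) (vs ! (k+n-1))]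
                @ map (\<lambda>i. vs ! (i - 1)) [k+n+1..<m+n+1])))
      = - act n (mirror \<phi>) (mirror \<theta>) (rev vs)"
      unfolding sg_sign odd sum_negf psgn_sum[symmetric]
        shuffle_action_sum[OF True, of \<theta> "\<lambda>c. \<rho> (\<phi> c)"] act_def mirror_def ..
    \<comment> \<open>The prefactor \<open>(-1)\<^sup>m\<^sup>n\<close> is that of the third term; the rest is the sign of exchanging the blocks.\<close>
    have par: "psgn (m * (k+n-1)) x = psgn (m * n) (psgn ((k - 1) * m) x)" if "k \<in> {1..n}" for k and x :: 'g
    proof -
      obtain j where "k = Suc j" using \<open>k \<in> {1..n}\<close> by (cases k) auto
      then show ?thesis by (auto simp: psgn_def)
    qed
    have "(\<Sum>k=1..n. \<Sum>\<sigma>\<in>shuffle_perms (k-1) m.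
         sg ((-1) ^ (m * (k+n-1)) * of_int (sign \<sigma>))
            (\<phi> (map (\<lambda>i. vs ! (\<sigma> i - 1)) [1..<k]
                @ [\<rho> (\<theta> (map (\<lambda>i. vs ! (\<sigma> i - 1)) [k..<k+m])) (vs ! (k+m-1))]
                @ map (\<lambda>i. vs ! (i - 1)) [k+m+1..<m+n+1])))
      = (\<Sum>k=1..n. psgn (m * n) (psgn ((k-1) * m) (\<Sum>\<sigma>\<in>shuffle_perms (k-1) m.
         perm_sgn \<sigma>
            (\<phi> (map (\<lambda>i. vs ! (\<sigma> i - 1)) [1..<k]
                @ [\<rho> (\<theta> (map (\<lambda>i. vs ! (\<sigma> i - 1)) [k..<k+m])) (vs ! (k+m-1))]
                @ map (\<lambda>i. vs ! (i - 1)) [k+m+1..<n+m+1])))))"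
      unfolding sg_sign psgn_sum[symmetric] add.commute[of n m]
      by (subst psgn_sum, rule sum.cong[OF refl]) (simp only: par)
    also have "\<dots> = psgn (m * n) (act m (mirror \<theta>) (mirror \<phi>) (rev vs))"
      unfolding psgn_sum[symmetric]
        shuffle_action_sum[OF True', of \<phi> "\<lambda>c. \<rho> (\<theta> c)"] act_def mirror_def ..
    finally have 3: "(\<Sum>k=1..n. \<Sum>\<sigma>\<in>shuffle_perms (k-1) m.
         sg ((-1) ^ (m * (k+n-1)) * of_int (sign \<sigma>))
            (\<phi> (map (\<lambda>i. vs ! (\<sigma> i - 1)) [1..<k]
                @ [\<rho> (\<theta> (map (\<lambda>i. vs ! (\<sigma> i - 1)) [k..<k+m])) (vs ! (k+m-1))]
                @ map (\<lambda>i. vs ! (i - 1)) [k+m+1..<m+n+1])))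
      = psgn (m * n) (act m (mirror \<theta>) (mirror \<phi>) (rev vs))" .
    have "(\<Sum>\<sigma>\<in>shuffle_perms m n.
         sg ((-1) ^ (m * n + 1) * of_int (sign \<sigma>))
            (brg (\<theta> (map (\<lambda>i. vs ! (\<sigma> i - 1)) [1..<m+1]))
                 (\<phi> (map (\<lambda>i. vs ! (\<sigma> i - 1)) [m+1..<m+n+1]))))
      = - psgn (m * n) (shuffle_sum m n vs (\<lambda>a b. brg (\<theta> a) (\<phi> b)))"
      unfolding sg_sign odd sum_negf psgn_sum[symmetric] shuffle_sum_def ..
    also have "shuffle_sum m n vs (\<lambda>a b. brg (\<theta> a) (\<phi> b)) =
       unshuffle (rev vs) (\<lambda>a b. if length a = m then brg (\<theta> (rev a)) (\<phi> (rev b)) else 0)"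
      by (rule shuffle_sum_unshuffle[OF True])
    also have "\<dots> = unshuffle (rev vs) (\<lambda>b a. psgn (length b * length a) (if length a = m then brg (\<theta> (rev a)) (\<phi> (rev b)) else 0))"
      by (rule unshuffle_commute)
    also have "\<dots> = unshuffle (rev vs) (\<lambda>b a. psgn (m * n) (brg (\<theta> (rev a)) (\<phi> (rev b))))"
      by (rule unshuffle_cong) (use True C_support[OF assms(1)] in \<open>auto simp: mult.commute brg_zero\<close>)
    also have "- psgn (m * n) \<dots> = - conv (mirror \<theta>) (mirror \<phi>) (rev vs)"
      by (simp add: unshuffle_psgn conv_def mirror_def)
    finally have 2: "(\<Sum>\<sigma>\<in>shuffle_perms m n.
         sg ((-1) ^ (m * n + 1) * of_int (sign \<sigma>))
            (brg (\<theta> (map (\<lambda>i. vs ! (\<sigma> i - 1)) [1..<m+1]))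
                 (\<phi> (map (\<lambda>i. vs ! (\<sigma> i - 1)) [m+1..<m+n+1]))))
       = - conv (mirror \<theta>) (mirror \<phi>) (rev vs)" .
    have "hom_br m n \<theta> \<phi> vs = - act n (mirror \<phi>) (mirror \<theta>) (rev vs) + - conv (mirror \<theta>) (mirror \<phi>) (rev vs)
       + psgn (m * n) (act m (mirror \<theta>) (mirror \<phi>) (rev vs))"
      unfolding hom_bracket_def Let_def if_P[OF True] 1 2 3 ..
    then show ?thesis
      by (simp add: subadj_def psgn_apply mirror_def[of "act _ _ _ - _ + _"])
  qed
qed

text \<open>In the sum over \<open>i < j\<close>, the coderivation \<open>\<delta>\<close> lets letter \<open>i\<close> act on letter \<open>j\<close>; moving letter \<open>i\<close>
  to the front gives the sign \<open>(-1)\<^sup>i\<^sup>-\<^sup>1\<close>.\<close>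

lemma hom_d_eq:
  assumes "f \<in> C n" "n \<ge> 1"
  shows "hom_diff n f = psgn n (mirror (leib (mirror f)))"
proof
  fix vs
  show "hom_diff n f vs = psgn n (mirror (leib (mirror f))) vs"
  proof (cases "length vs = n + 1")
    case False
    then show ?thesis
      using C_support[OF leib_in_C[OF C_mirror[OF assms(1)]], of "rev vs"]
      by (simp add: hom_d_def mirror_def psgn_apply)
  next
    case True
    let ?t = "\<lambda>i j. f (map (\<lambda>i. vs ! (i - 1)) ([1..<i] @ [i+1..<j]) @ [brh (vs ! (i - 1)) (vs ! (j - 1))]
        @ map (\<lambda>i. vs ! (i - 1)) [j+1..<n+2])"
    have par: "psgn (n + i - Suc 0) x = psgn n (psgn (i - Suc 0) x)" if "Suc 0 \<le> i" for i and x :: 'g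
    proof -
      have "even (n + i - Suc 0) \<longleftrightarrow> even (n + (i - Suc 0))"
        using that by (cases i) auto
      then show ?thesis by (simp add: psgn_def)
    qed
    have "hom_diff n f vs = (\<Sum>(i, j) | 1 \<le> i \<and> i < j \<and> j \<le> n + 1. psgn (n - 1 + i) (?t i j))"
      unfolding hom_d_def Let_def if_P[OF True] sg_power ..
    also have "\<dots> = (\<Sum>(k, i)\<in>(SIGMA k:{1..n}. {..<k}). psgn n (psgn i (?t (i+1) (k+1))))"
      by (rule sum.reindex_bij_witness[of _ "\<lambda>(k, i). (i+1, k+1)" "\<lambda>(i, j). (j-1, i-1)"])
        (auto simp: par simp del: upt_Suc)
    also have "\<dots> = psgn n (\<Sum>k=1..n. \<Sum>i<k. psgn i (?t (i+1) (k+1)))"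
      unfolding psgn_sum by (rule sum.Sigma[symmetric]) auto
    also have "(\<Sum>k=1..n. \<Sum>i<k. psgn i (?t (i+1) (k+1))) = leib (mirror f) (rev vs)"
      unfolding leib_def coderiv_rev[OF True]
    proof (rule sum.cong[OF refl])
      fix k assume k: "k \<in> {1..n}"
      let ?G = "\<lambda>x a. f (rev a @ brh x (vs ! k) # drop (k + 1) vs)"
      have "(\<Sum>i<k. psgn i (?t (i+1) (k+1))) =
        (\<Sum>i<length (take k vs). psgn i (?G (take k vs ! i) (rev (take i (take k vs) @ drop (Suc i) (take k vs)))))"
      proof (rule sum.cong)
        show "{..<k} = {..<length (take k vs)}" using k True by simp
        fix i assume i: "i \<in> {..<length (take k vs)}"
        have "map (\<lambda>i. vs ! (i - 1)) [1..<i+1] = take i (take k vs)"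
          using map_nth_interval[of i vs 0] i True k by (simp add: min_def del: upt_Suc)
        moreover have "map (\<lambda>i. vs ! (i - 1)) [i+1+1..<k+1] = drop (Suc i) (take k vs)"
          using map_nth_interval[of k vs "Suc i"] i True k by (simp add: drop_take del: upt_Suc)
        moreover have "map (\<lambda>i. vs ! (i - 1)) [k+1+1..<n+2] = drop (k + 1) vs"
          using map_nth_interval[of "n+1" vs "k+1"] True by (simp del: upt_Suc)
        ultimately show "psgn i (?t (i+1) (k+1)) = psgn i (?G (take k vs ! i) (rev (take i (take k vs) @ drop (Suc i) (take k vs))))"
          using i by (simp del: upt_Suc)
      qed
      also have "\<dots> = unshuffle (rev (take k vs)) (\<lambda>c a. if length c = 1 then ?G (hd c) a else 0)"
        by (rule unshuffle_left_single[symmetric])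
      also have "\<dots> = unshuffle (rev (take (k+1-1) vs))
         (\<lambda>c a. if length c = 1 then mirror f (rev (drop (k+1) vs) @ ad c (vs ! (k+1-1)) # a) else 0)"
        by (auto simp: mirror_def ad_def intro!: unshuffle_cong)
      finally show "(\<Sum>i<k. psgn i (?t (i+1) (k+1))) = unshuffle (rev (take (k+1-1) vs))
         (\<lambda>c a. if length c = 1 then mirror f (rev (drop (k+1) vs) @ ad c (vs ! (k+1-1)) # a) else 0)" .
    qed
    finally show ?thesis by (simp add: psgn_apply mirror_def[of "leib _"])
  qed
qed

section \<open>Linearity and identities of the homogeneous operations\<close>

lemma cscale_apply: "cscale c f vs = sg c (f vs)"
  by (simp add: cochain_scale_def)

lemma vector_space_cscale: "vector_space cscale"
  by unfold_locales
    (auto simp: cochain_scale_def fun_eq_iff g.scale_right_distrib g.scale_left_distrib)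

lemma cscale_sign: "cscale ((- 1) ^ k) f = psgn k f"
  by (rule ext) (simp add: cscale_apply sg_power psgn_apply)

lemma C_scale:
  assumes "f \<in> C n" shows "cscale c f \<in> C n"
  using assms linear_scale[of sh sg] by (auto simp: C_iff cscale_apply multilinear_def)

lemma zero_in_C: "0 \<in> C n"
  by (simp add: C_iff multilinear_def zero_fun_def linear_const_zero vector_spaces)

lemma mirror_zero: "mirror 0 = 0"
  by (rule ext) (simp add: mirror_def)

lemma mirror_scale: "mirror (cscale c f) = cscale c (mirror f)"
  by (simp add: mirror_def fun_eq_iff cscale_apply)

lemma act_scale: "act n \<phi> (cscale c \<theta>) = cscale c (act n \<phi> \<theta>)"
  by (rule ext) (simp add: act_def cscale_apply coderiv_hom[of "sg c"] g.scale_right_distrib cochain_scale_def[of sg c \<theta>])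

lemma act_scale_op: "\<theta> \<in> C m \<Longrightarrow> act n (cscale c \<phi>) \<theta> = cscale c (act n \<phi> \<theta>)"
  using coderiv_scale_op[OF C_multilinear, of \<theta> m n c "\<lambda>c. \<rho> (\<phi> c)"]
  by (intro ext) (simp add: act_def cscale_apply rho_scale[abs_def])

lemma brg_scale: "brg (sg c x) y = sg c (brg x y)" "brg x (sg c y) = sg c (brg x y)"
  using g.linear_left[of y] g.linear_right[of x] by (simp_all add: linear_unfold)

lemma conv_scale: "conv (cscale c \<theta>) \<phi> = cscale c (conv \<theta> \<phi>)" "conv \<theta> (cscale c \<phi>) = cscale c (conv \<theta> \<phi>)"
  by (rule ext, simp add: conv_def cscale_apply brg_scale unshuffle_hom[of "sg c"] g.scale_right_distrib)+

lemma cscale_psgn: "cscale c (psgn n f) = psgn n (cscale c f)"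
  by (rule ext) (simp add: psgn_def cscale_apply)

lemma cscale_zero: "cscale c 0 = 0"
  by (rule ext) (simp add: cscale_apply)

lemma cscale_add: "cscale c (f + g) = cscale c f + cscale c g"
  by (rule ext) (simp add: cscale_apply g.scale_right_distrib)

lemma cscale_minus: "cscale c (- f) = - cscale c f"
  by (rule ext) (simp add: cscale_apply)

lemma cscale_diff: "cscale c (f - g) = cscale c f - cscale c g"
  by (rule ext) (simp add: cscale_apply g.scale_right_diff_distrib)

lemma subadj_scale_left:
  "\<phi> \<in> C n \<Longrightarrow> subadj m n (cscale c \<theta>) \<phi> = cscale c (subadj m n \<theta> \<phi>)"
  by (simp add: subadj_def act_scale act_scale_op conv_scale cscale_psgn cscale_add cscale_diff)

lemma subadj_scale_right:
  "\<theta> \<in> C m \<Longrightarrow> subadj m n \<theta> (cscale c \<phi>) = cscale c (subadj m n \<theta> \<phi>)"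
  by (simp add: subadj_def act_scale act_scale_op conv_scale cscale_psgn cscale_add cscale_diff)

lemma subadj_add_left:
  "\<phi> \<in> C n \<Longrightarrow> subadj m n (\<theta> + \<theta>') \<phi> = subadj m n \<theta> \<phi> + subadj m n \<theta>' \<phi>"
  by (simp add: subadj_def act_add act_add_op conv_add psgn_add algebra_simps)

lemma subadj_add_right:
  "\<theta> \<in> C m \<Longrightarrow> subadj m n \<theta> (\<phi> + \<phi>') = subadj m n \<theta> \<phi> + subadj m n \<theta> \<phi>'"
  by (simp add: subadj_def act_add act_add_op conv_add psgn_add algebra_simps)

lemma subadj_minus_left:
  "\<phi> \<in> C n \<Longrightarrow> subadj m n (- \<theta>) \<phi> = - subadj m n \<theta> \<phi>"
  by (simp add: subadj_def act_minus act_minus_op conv_minus psgn_minus algebra_simps)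

lemma subadj_minus_right:
  "\<theta> \<in> C m \<Longrightarrow> subadj m n \<theta> (- \<phi>) = - subadj m n \<theta> \<phi>"
  by (simp add: subadj_def act_minus act_minus_op conv_minus psgn_minus algebra_simps)

lemma subadj_psgn_left:
  "\<phi> \<in> C n \<Longrightarrow> subadj m n (psgn k \<theta>) \<phi> = psgn k (subadj m n \<theta> \<phi>)"
  by (simp add: psgn_def subadj_minus_left)

lemma subadj_psgn_right:
  "\<theta> \<in> C m \<Longrightarrow> subadj m n \<theta> (psgn k \<phi>) = psgn k (subadj m n \<theta> \<phi>)"
  by (simp add: psgn_def subadj_minus_right)

lemma leib_scale: "leib (cscale c f) = cscale c (leib f)"
  by (rule ext) (simp add: leib_def cscale_apply coderiv_hom[of "sg c"] g.scale_right_distrib cochain_scale_def[of sg c f])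

lemma leib_psgn: "leib (psgn n f) = psgn n (leib f)"
  by (simp add: psgn_def leib_minus)

lemma leib_leib_zero:
  fixes f :: "'h list \<Rightarrow> 'g"
  assumes "f \<in> C n" "(2 :: 'k) \<noteq> 0"
  shows "leib (leib f) = 0"
proof
  fix w
  have "leib (leib f) w + leib (leib f) w = 0"
    using fun_cong[OF leib_leib[OF assms(1)], of w] by simp
  then have "sg 2 (leib (leib f) w) = 0"
    using g.scale_left_distrib[of 1 1 "leib (leib f) w"] by simp
  then show "leib (leib f) w = 0 w" using assms(2) by simp
qed

lemma hom_br_in_C: "\<theta> \<in> C m \<Longrightarrow> \<phi> \<in> C n \<Longrightarrow> hom_br m n \<theta> \<phi> \<in> C (m + n)"
  by (simp add: hom_bracket_eq C_minus C_mirror subadj_in_C)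

lemma hom_diff_in_C: "f \<in> C n \<Longrightarrow> n \<ge> 1 \<Longrightarrow> hom_diff n f \<in> C (n + 1)"
  unfolding hom_d_eq by (intro C_psgn C_mirror leib_in_C)

lemma hom_diff_zero_degree: "hom_diff 0 f = 0"
proof
  have "{(i, j). 1 \<le> i \<and> i < j \<and> j \<le> 0 + (1::nat)} = {}" by auto
  then show "hom_diff 0 f vs = 0 vs" for vs
    unfolding hom_d_def Let_def by (simp only: sum.empty if_cancel zero_fun_apply)
qed

lemma hom_diff_add: "f \<in> C n \<Longrightarrow> g \<in> C n \<Longrightarrow> hom_diff n (f + g) = hom_diff n f + hom_diff n g"
  by (cases n) (simp_all add: hom_d_eq C_add mirror_add leib_add psgn_add hom_diff_zero_degree)

lemma hom_diff_scale: "f \<in> C n \<Longrightarrow> hom_diff n (cscale c f) = cscale c (hom_diff n f)"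
  by (cases n) (simp_all add: hom_d_eq C_scale mirror_scale leib_scale cscale_psgn hom_diff_zero_degree cscale_zero)

lemma hom_diff_hom_diff:
  assumes "f \<in> C n" "(2 :: 'k) \<noteq> 0"
  shows "hom_diff (n + 1) (hom_diff n f) = 0"
proof (cases "n \<ge> 1")
  case True
  then have "hom_diff (n + 1) (hom_diff n f) = psgn (n + 1) (psgn n (mirror (leib (leib (mirror f)))))"
    using assms by (simp add: hom_d_eq hom_diff_in_C[OF _ True, simplified hom_d_eq] C_psgn C_mirror leib_in_C[simplified] mirror_psgn leib_psgn)
  then show ?thesis
    by (simp add: leib_leib_zero[OF C_mirror[OF assms(1)] assms(2)] mirror_zero)
next
  case False
  then have "n = 0" by simp
  then show ?thesis
    using hom_diff_add[OF zero_in_C zero_in_C, of 1] by (simp add: hom_diff_zero_degree)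
qed

lemma hom_br_add_left: "\<theta> \<in> C m \<Longrightarrow> \<theta>' \<in> C m \<Longrightarrow> \<phi> \<in> C n \<Longrightarrow> hom_br m n (\<theta> + \<theta>') \<phi> = hom_br m n \<theta> \<phi> + hom_br m n \<theta>' \<phi>"
  by (simp add: hom_bracket_eq C_add mirror_add subadj_add_left C_mirror)

lemma hom_br_add_right: "\<theta> \<in> C m \<Longrightarrow> \<phi> \<in> C n \<Longrightarrow> \<phi>' \<in> C n \<Longrightarrow> hom_br m n \<theta> (\<phi> + \<phi>') = hom_br m n \<theta> \<phi> + hom_br m n \<theta> \<phi>'"
  by (simp add: hom_bracket_eq C_add mirror_add subadj_add_right C_mirror)

lemma hom_br_scale_left: "\<theta> \<in> C m \<Longrightarrow> \<phi> \<in> C n \<Longrightarrow> hom_br m n (cscale c \<theta>) \<phi> = cscale c (hom_br m n \<theta> \<phi>)"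
  by (simp add: hom_bracket_eq C_scale mirror_scale subadj_scale_left C_mirror cscale_minus)

lemma hom_br_scale_right: "\<theta> \<in> C m \<Longrightarrow> \<phi> \<in> C n \<Longrightarrow> hom_br m n \<theta> (cscale c \<phi>) = cscale c (hom_br m n \<theta> \<phi>)"
  by (simp add: hom_bracket_eq C_scale mirror_scale subadj_scale_right C_mirror cscale_minus)

lemma hom_br_anti:
  assumes "\<theta> \<in> C m" "\<phi> \<in> C n"
  shows "hom_br m n \<theta> \<phi> = - psgn (m * n) (hom_br n m \<phi> \<theta>)"
  using subadj_anti[OF C_mirror[OF assms(1)] C_mirror[OF assms(2)]]
  by (simp add: hom_bracket_eq assms mirror_minus mirror_psgn psgn_minus)

lemma hom_br_jacobi:
  assumes "\<theta> \<in> C m" "\<phi> \<in> C n" "\<psi> \<in> C p"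
  shows "hom_br m (n + p) \<theta> (hom_br n p \<phi> \<psi>) = hom_br (m + n) p (hom_br m n \<theta> \<phi>) \<psi> + psgn (m * n) (hom_br n (m + p) \<phi> (hom_br m p \<theta> \<psi>))"
proof -
  note C = assms hom_br_in_C[OF assms(2,3)] hom_br_in_C[OF assms(1,2)] hom_br_in_C[OF assms(1,3)]
  have "hom_br m (n + p) \<theta> (hom_br n p \<phi> \<psi>) = mirror (subadj m (n + p) (mirror \<theta>) (subadj n p (mirror \<phi>) (mirror \<psi>)))"
    by (subst hom_bracket_eq[OF C(1,4)], subst hom_bracket_eq[OF C(2,3)])
      (simp add: mirror_minus subadj_minus_right[OF C_mirror[OF assms(1)]])
  moreover have "hom_br n (m + p) \<phi> (hom_br m p \<theta> \<psi>) = mirror (subadj n (m + p) (mirror \<phi>) (subadj m p (mirror \<theta>) (mirror \<psi>)))"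
    by (subst hom_bracket_eq[OF C(2,6)], subst hom_bracket_eq[OF C(1,3)])
      (simp add: mirror_minus subadj_minus_right[OF C_mirror[OF assms(2)]])
  moreover have "hom_br (m + n) p (hom_br m n \<theta> \<phi>) \<psi> = mirror (subadj (m + n) p (subadj m n (mirror \<theta>) (mirror \<phi>)) (mirror \<psi>))"
    by (subst hom_bracket_eq[OF C(5,3)], subst hom_bracket_eq[OF C(1,2)])
      (simp add: mirror_minus subadj_minus_left[OF C_mirror[OF assms(3)]])
  ultimately show ?thesis
    by (simp add: subadj_jacobi[OF assms[THEN C_mirror]] mirror_add mirror_psgn)
qed

text \<open>The sign \<open>(-1)\<^sup>n\<close> in the differential turns the rule for \<open>\<delta>\<close>, which acts from the right, into the
  usual left Leibniz rule.\<close>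

lemma hom_diff_bracket:
  assumes "\<theta> \<in> C m" "\<phi> \<in> C n" "m \<ge> 1" "n \<ge> 1"
  shows "hom_diff (m + n) (hom_br m n \<theta> \<phi>) = hom_br (m + 1) n (hom_diff m \<theta>) \<phi> + psgn m (hom_br m (n + 1) \<theta> (hom_diff n \<phi>))"
proof -
  note R = assms(1,2)[THEN C_mirror]
  have "hom_diff (m + n) (hom_br m n \<theta> \<phi>) = - psgn (m + n) (mirror (leib (subadj m n (mirror \<theta>) (mirror \<phi>))))"
    using assms(3) hom_d_eq[OF hom_br_in_C[OF assms(1,2)]]
    by (simp add: hom_bracket_eq assms mirror_minus leib_minus psgn_minus)
  moreover have "hom_br (m + 1) n (hom_diff m \<theta>) \<phi> = - psgn m (mirror (subadj (m + 1) n (leib (mirror \<theta>)) (mirror \<phi>)))"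
    by (subst hom_bracket_eq[OF hom_diff_in_C[OF assms(1,3)] assms(2)], subst hom_d_eq[OF assms(1,3)])
      (simp add: mirror_psgn subadj_psgn_left[OF R(2)])
  moreover have "hom_br m (n + 1) \<theta> (hom_diff n \<phi>) = - psgn n (mirror (subadj m (n + 1) (mirror \<theta>) (leib (mirror \<phi>))))"
    by (subst hom_bracket_eq[OF assms(1) hom_diff_in_C[OF assms(2,4)]], subst hom_d_eq[OF assms(2,4)])
      (simp add: mirror_psgn subadj_psgn_right[OF R(1)])
  ultimately show ?thesis
    by (simp add: leib_subadj[OF R] mirror_add mirror_minus psgn_def algebra_simps)
qed

section \<open>The differential graded Lie algebra\<close>

abbreviation "V \<equiv> cochains sh sg"
abbreviation "Cdeg \<equiv> cochain_deg sh sg"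
abbreviation "cb \<equiv> cochain_bracket sg brg \<rho>"
abbreviation "cd \<equiv> cochain_d sg brh"

lemma component_apply: "component n f vs = (if length vs = n then f vs else 0)"
  by (simp add: component_def)

lemma component_add: "component n (f + g) = component n f + component n g"
  by (simp add: component_def fun_eq_iff)

lemma component_scale: "component n (cscale c f) = cscale c (component n f)"
  by (auto simp: component_def fun_eq_iff cscale_apply)

lemma component_zero: "component n 0 = 0"
  by (simp add: component_def fun_eq_iff)

lemma V_component:
  assumes "f \<in> V" shows "component n f \<in> C n"
proof (cases "n \<ge> 1")
  case False
  have "component n f = 0"
  proof
    fix vs
    show "component n f vs = 0 vs"
      using assms False by (cases vs) (auto simp: cochains_def component_def)
  qed
  then show ?thesis by (simp add: zero_in_C)
qed (use assms in \<open>auto simp: cochains_def\<close>)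

lemma V_zero: "0 \<in> V"
  by (simp add: cochains_def component_zero zero_in_C)

lemma V_add:
  assumes "f \<in> V" "g \<in> V" shows "f + g \<in> V"
proof -
  have "finite {n. component n (f + g) \<noteq> 0}"
    by (rule finite_subset[of _ "{n. component n f \<noteq> 0} \<union> {n. component n g \<noteq> 0}"])
      (use assms in \<open>auto simp: cochains_def component_add\<close>)
  then show ?thesis using assms by (auto simp: cochains_def component_add C_add)
qed

lemma V_scale:
  assumes "f \<in> V" shows "cscale c f \<in> V"
proof -
  have "finite {n. component n (cscale c f) \<noteq> 0}"
    by (rule finite_subset[of _ "{n. component n f \<noteq> 0}"])
      (use assms in \<open>auto simp: cochains_def component_scale fun_eq_iff cscale_apply\<close>)
  then show ?thesis using assms by (auto simp: cochains_def component_scale C_scale cscale_apply)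
qed

lemma C_subset_V:
  assumes "f \<in> C n" "n \<ge> 1" shows "f \<in> V"
proof -
  have "f [] = 0" using C_support[OF assms(1), of "[]"] assms(2) by auto
  moreover have "{k. component k f \<noteq> 0} \<subseteq> {n}"
    by (auto simp: component_hom_tensor[OF assms(1)])
  ultimately show ?thesis
    using assms by (auto simp: cochains_def component_hom_tensor[OF assms(1)] zero_in_C intro: finite_subset)
qed

text \<open>Reduces an identity for homogeneous elements to positive degrees; in the other degrees all elements
  are zero.\<close>

lemma Cdeg_cases:
  assumes "x \<in> Cdeg p"
  obtains "x = 0" "x \<in> V" | n where "p = int n" "n \<ge> 1" "x \<in> C n" "x \<in> V"
proof (cases "p \<ge> 1")
  case True
  then have "x \<in> C (nat p)" "nat p \<ge> 1" using assms by (auto simp: cochain_deg_def)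
  then show ?thesis using that(2)[of "nat p"] True C_subset_V by auto
next
  case False
  then show ?thesis using that(1) assms V_zero by (simp add: cochain_deg_def)
qed

lemma C_Cdeg: "x \<in> C n \<Longrightarrow> n \<ge> 1 \<Longrightarrow> x \<in> Cdeg (int n)"
  by (simp add: cochain_deg_def)

lemma zero_Cdeg: "0 \<in> Cdeg p"
  by (simp add: cochain_deg_def zero_in_C)

lemma Cdeg_add: "x \<in> Cdeg p \<Longrightarrow> y \<in> Cdeg p \<Longrightarrow> x + y \<in> Cdeg p"
  by (auto simp: cochain_deg_def C_add split: if_splits)

lemma Cdeg_scale: "x \<in> Cdeg p \<Longrightarrow> cscale c x \<in> Cdeg p"
  by (auto simp: cochain_deg_def C_scale split: if_splits) (simp add: cscale_apply fun_eq_iff)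

text \<open>The component in degree \<open>p\<close> is the restriction to words of length \<open>p\<close>, and evaluating a
  decomposition at such a word shows that nothing else is possible.\<close>

lemma Cdeg_direct_sum:
  assumes x: "x \<in> V"
  shows "\<exists>!c. (\<forall>p. c p \<in> Cdeg p) \<and> finite {p. c p \<noteq> 0} \<and> x = (\<Sum>p | c p \<noteq> 0. c p)"
proof
  \<comment> \<open>The default 0 is the only element in degrees below 1.\<close>
  define c where "c p = (if p \<ge> 1 then component (nat p) x else 0)" for p :: int
  have "{p. c p \<noteq> 0} \<subseteq> int ` {n. component n x \<noteq> 0}"
    by (auto simp: c_def image_iff) (metis int_nat_eq order_trans zero_le_one)
  moreover have "finite {n. component n x \<noteq> 0}" using x by (simp add: cochains_def)
  ultimately have fin: "finite {p. c p \<noteq> 0}" by (meson finite_imageI finite_subset)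
  have deg: "c p \<in> Cdeg p" for p
    using V_component[OF x] by (auto simp: c_def cochain_deg_def)
  have "x vs = (\<Sum>p | c p \<noteq> 0. c p) vs" for vs
  proof -
    have x0: "x [] = 0" using x by (simp add: cochains_def)
    have "(\<Sum>p | c p \<noteq> 0. c p) vs = (\<Sum>p | c p \<noteq> 0. if p = int (length vs) then x vs else 0)"
      unfolding sum_apply by (rule sum.cong) (auto simp: c_def component_apply x0)
    also have "\<dots> = (if c (int (length vs)) \<noteq> 0 then x vs else 0)"
      using fin by (simp add: sum.delta)
    also have "\<dots> = x vs"
    proof (cases "c (int (length vs)) = 0")
      case True
      then have "c (int (length vs)) vs = 0" by simp
      then have "x vs = 0"
        using x0 by (cases "vs = []") (auto simp: c_def component_apply Suc_le_eq split: if_splits)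
      then show ?thesis by simp
    qed simp
    finally show ?thesis by simp
  qed
  then show "(\<forall>p. c p \<in> Cdeg p) \<and> finite {p. c p \<noteq> 0} \<and> x = (\<Sum>p | c p \<noteq> 0. c p)"
    using fin deg by blast
  fix c' assume c': "(\<forall>p. c' p \<in> Cdeg p) \<and> finite {p. c' p \<noteq> 0} \<and> x = (\<Sum>p | c' p \<noteq> 0. c' p)"
  have supp: "c' q vs = 0" if "q \<noteq> int (length vs)" for q vs
    using c'[THEN conjunct1, rule_format, of q] that
    by (cases rule: Cdeg_cases) (auto intro: C_support)
  show "c' = c"
  proof (rule ext, rule ext)
    fix p vs
    show "c' p vs = c p vs"
    proof (cases "p \<ge> 1 \<and> p = int (length vs)")
      case False
      then have "c' p vs = 0"
        using supp[of p vs] c'[THEN conjunct1, rule_format, of p]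
        by (auto simp: cochain_deg_def split: if_splits)
      then show ?thesis using False by (auto simp: c_def component_apply)
    next
      case True
      have "x vs = (\<Sum>q | c' q \<noteq> 0. c' q) vs" using c' by simp
      also have "\<dots> = (\<Sum>q | c' q \<noteq> 0. if q = p then c' p vs else 0)"
        unfolding sum_apply by (rule sum.cong) (use supp True in auto)
      also have "\<dots> = c' p vs"
        using c' by (auto simp: sum.delta)
      finally show ?thesis using True by (simp add: c_def component_apply)
    qed
  qed
qed

lemma cb_add_left: "x \<in> V \<Longrightarrow> y \<in> V \<Longrightarrow> z \<in> V \<Longrightarrow> cb (x + y) z = cb x z + cb y z"
  by (rule ext) (simp add: cochain_bracket_def component_add hom_br_add_left V_component sum.distrib)

lemma cb_add_right: "x \<in> V \<Longrightarrow> y \<in> V \<Longrightarrow> z \<in> V \<Longrightarrow> cb x (y + z) = cb x y + cb x z"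
  by (rule ext) (simp add: cochain_bracket_def component_add hom_br_add_right V_component sum.distrib)

lemma cb_scale_left: "x \<in> V \<Longrightarrow> y \<in> V \<Longrightarrow> cb (cscale c x) y = cscale c (cb x y)"
  by (rule ext) (simp add: cochain_bracket_def component_scale hom_br_scale_left V_component cscale_apply g.scale_sum_right)

lemma cb_scale_right: "x \<in> V \<Longrightarrow> y \<in> V \<Longrightarrow> cb x (cscale c y) = cscale c (cb x y)"
  by (rule ext) (simp add: cochain_bracket_def component_scale hom_br_scale_right V_component cscale_apply g.scale_sum_right)

lemma cb_zero: "y \<in> V \<Longrightarrow> cb 0 y = 0" "y \<in> V \<Longrightarrow> cb y 0 = 0"
  using cb_add_left[of 0 0 y] cb_add_right[of y 0 0] V_zero by auto

lemma cd_add: "x \<in> V \<Longrightarrow> y \<in> V \<Longrightarrow> cd (x + y) = cd x + cd y"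
  by (rule ext) (simp add: cochain_d_def component_add hom_diff_add V_component)

lemma cd_scale: "x \<in> V \<Longrightarrow> cd (cscale c x) = cscale c (cd x)"
  by (rule ext) (simp add: cochain_d_def component_scale hom_diff_scale V_component cscale_apply)

lemma cd_zero: "cd 0 = 0"
  using cd_add[of 0 0] V_zero by auto

lemma cb_hom: "x \<in> C m \<Longrightarrow> y \<in> C n \<Longrightarrow> m \<ge> 1 \<Longrightarrow> n \<ge> 1 \<Longrightarrow> cb x y = hom_br m n x y"
  by (rule cochain_bracket_homogeneous)

lemma cd_hom: "x \<in> C n \<Longrightarrow> n \<ge> 1 \<Longrightarrow> cd x = hom_diff n x"
  by (rule cochain_d_homogeneous[OF _ _ vector_spaces(2)])

lemma cscale_powi: "cscale ((- 1) powi (int k)) f = psgn k f"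
  by (simp add: cscale_sign)

lemma cd_cd:
  assumes "x \<in> V" "(2 :: 'k) \<noteq> 0" shows "cd (cd x) = 0"
proof
  fix vs
  show "cd (cd x) vs = 0 vs"
  proof (cases "length vs - 1 \<ge> 1")
    case False
    then show ?thesis by (simp add: cochain_d_def[of _ _ "cd x"] hom_diff_zero_degree)
  next
    case True
    then obtain k where k: "length vs - 1 = k + 1" by (metis Suc_eq_plus1 Suc_le_D One_nat_def)
    have "component (k + 1) (cd x) = hom_diff k (component k x)"
    proof
      fix us
      show "component (k + 1) (cd x) us = hom_diff k (component k x) us"
        by (cases "length us = k + 1") (simp_all add: component_apply cochain_d_def hom_d_def[of _ _ k])
    qed
    then show ?thesis
      unfolding cochain_d_def[of _ _ "cd x"] k using hom_diff_hom_diff[OF V_component[OF assms(1)] assms(2)] by simp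
  qed
qed

lemma dg_lie_algebra_cochains:
  assumes "(2 :: 'k) \<noteq> 0"
  shows "dg_lie_algebra cscale V Cdeg cb cd"
proof -
  interpret W: vector_space cscale by (rule vector_space_cscale)
  show ?thesis
  proof unfold_locales
    show "W.subspace V" by (simp add: W.subspace_def V_zero V_add V_scale)
    show "W.subspace (Cdeg p)" for p by (simp add: W.subspace_def zero_Cdeg Cdeg_add Cdeg_scale)
    show "Cdeg p \<subseteq> V" for p by (auto elim: Cdeg_cases)
    show "\<exists>!c. (\<forall>p. c p \<in> Cdeg p) \<and> finite {p. c p \<noteq> 0} \<and> x = (\<Sum>p | c p \<noteq> 0. c p)" if "x \<in> V" for x
      using that by (rule Cdeg_direct_sum)
  next
    fix x y z assume "x \<in> V" "y \<in> V" "z \<in> V"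
    then show "cb (x + y) z = cb x z + cb y z" "cb x (y + z) = cb x y + cb x z"
      by (simp_all add: cb_add_left cb_add_right)
  next
    fix x y c assume "x \<in> V" "y \<in> V"
    then show "cb (cscale c x) y = cscale c (cb x y)" "cb x (cscale c y) = cscale c (cb x y)" "cd (x + y) = cd x + cd y"
      by (simp_all add: cb_scale_left cb_scale_right cd_add)
  next
    fix x c assume "x \<in> V"
    then show "cd (cscale c x) = cscale c (cd x)" "cd (cd x) = 0"
      by (simp_all add: cd_scale cd_cd assms)
  next
    fix x y p q assume x: "x \<in> Cdeg p" and y: "y \<in> Cdeg q"
    show "cb x y \<in> Cdeg (p + q)"
      using x
    proof (cases rule: Cdeg_cases)
      case 1 show ?thesis using y by (cases rule: Cdeg_cases) (use 1 in \<open>auto simp: cb_zero zero_Cdeg\<close>)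
    next
      case (2 m)
      note m = this
      show ?thesis using y
      proof (cases rule: Cdeg_cases)
        case (2 n)
        then show ?thesis using m C_Cdeg[OF hom_br_in_C[OF m(3) 2(3)]] by (simp add: cb_hom)
      qed (use m in \<open>auto simp: cb_zero zero_Cdeg\<close>)
    qed
    show "cb x y = - cscale ((- 1) powi (p * q)) (cb y x)"
      using x
    proof (cases rule: Cdeg_cases)
      case 1 show ?thesis using y by (cases rule: Cdeg_cases) (use 1 in \<open>auto simp: cb_zero cscale_zero\<close>)
    next
      case (2 m)
      note m = this
      show ?thesis using y
      proof (cases rule: Cdeg_cases)
        case (2 n)
        have "p * q = int (m * n)" using m 2 by simp
        then show ?thesis using hom_br_anti[OF m(3) 2(3)] m 2 by (simp only: cb_hom cscale_powi)
      qed (use m in \<open>auto simp: cb_zero cscale_zero\<close>)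
    qed
    show "cd (cb x y) = cb (cd x) y + cscale ((- 1) powi p) (cb x (cd y))"
      using x
    proof (cases rule: Cdeg_cases)
      case 1
      have "cd y \<in> V" using y
        by (cases rule: Cdeg_cases)
          (auto simp: cd_zero V_zero cd_hom intro!: C_subset_V[OF hom_diff_in_C])
      show ?thesis using y
        by (cases rule: Cdeg_cases) (use 1 \<open>cd y \<in> V\<close> in \<open>auto simp: cb_zero cscale_zero cd_zero\<close>)
    next
      case (2 m)
      note m = this
      show ?thesis using y
      proof (cases rule: Cdeg_cases)
        case 1
        have "cd x \<in> V" using m by (auto simp: cd_hom intro!: C_subset_V[OF hom_diff_in_C])
        then show ?thesis using m 1 by (simp add: cb_zero cscale_zero cd_zero)
      next
        case (2 n)
        have "cb (cd x) y = hom_br (m + 1) n (hom_diff m x) y" "cb x (cd y) = hom_br m (n + 1) x (hom_diff n y)"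
          using cb_hom[OF hom_diff_in_C[OF m(3,2)] 2(3)] cb_hom[OF m(3) hom_diff_in_C[OF 2(3,2)]]
            cd_hom[OF m(3,2)] cd_hom[OF 2(3,2)] m 2 by simp_all
        moreover have "cd (cb x y) = hom_diff (m + n) (hom_br m n x y)"
          using cd_hom[OF hom_br_in_C[OF m(3) 2(3)]] m 2 by (simp add: cb_hom)
        ultimately show ?thesis
          using hom_diff_bracket[OF m(3) 2(3) m(2) 2(2)] m(1) by (simp only: cscale_powi)
      qed
    qed
  next
    fix x p assume "x \<in> Cdeg p"
    then show "cd x \<in> Cdeg (p + 1)"
    proof (cases rule: Cdeg_cases)
      case (2 n)
      then show ?thesis using C_Cdeg[OF hom_diff_in_C[OF 2(3,2)]] by (simp add: cd_hom add.commute)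
    qed (simp add: cd_zero zero_Cdeg)
  next
    fix x y z p q r assume x: "x \<in> Cdeg p" and y: "y \<in> Cdeg q" and z: "z \<in> Cdeg r"
    have V: "cb u v \<in> V" if "u \<in> Cdeg p'" "v \<in> Cdeg q'" for u v p' q'
      using that(1)
    proof (cases rule: Cdeg_cases)
      case 1 show ?thesis using that(2) by (cases rule: Cdeg_cases) (use 1 in \<open>auto simp: cb_zero V_zero\<close>)
    next
      case (2 m)
      note m = this
      show ?thesis using that(2)
      proof (cases rule: Cdeg_cases)
        case (2 n)
        then show ?thesis using m C_subset_V[OF hom_br_in_C[OF m(3) 2(3)]] by (simp add: cb_hom)
      qed (use m in \<open>auto simp: cb_zero V_zero\<close>)
    qed
    note VV = V[OF x y] V[OF y z] V[OF x z]
    have inV: "x \<in> V" "y \<in> V" "z \<in> V" using x y z by (auto elim: Cdeg_cases)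
    show "cb x (cb y z) = cb (cb x y) z + cscale ((- 1) powi (p * q)) (cb y (cb x z))"
    proof (cases "x = 0 \<or> y = 0 \<or> z = 0")
      case True
      then show ?thesis using VV inV by (auto simp: cb_zero cscale_zero)
    next
      case False
      obtain m where m: "p = int m" "m \<ge> 1" "x \<in> C m" using x False by (cases rule: Cdeg_cases) auto
      obtain n where n: "q = int n" "n \<ge> 1" "y \<in> C n" using y False by (cases rule: Cdeg_cases) auto
      obtain k where k: "r = int k" "k \<ge> 1" "z \<in> C k" using z False by (cases rule: Cdeg_cases) auto
      have "p * q = int (m * n)" using m n by simp
      then show ?thesis
        using hom_br_jacobi[OF m(3) n(3) k(3)] m n k
          cb_hom[OF m(3) hom_br_in_C[OF n(3) k(3)]] cb_hom[OF n(3) hom_br_in_C[OF m(3) k(3)]]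
          cb_hom[OF hom_br_in_C[OF m(3) n(3)] k(3)]
        by (simp add: cb_hom cscale_sign del: of_nat_mult)
    qed
  qed
qed

section \<open>Maurer-Cartan elements\<close>

lemma cochain_of_map_in_C:
  "cochain_of_map T \<in> C 1 \<longleftrightarrow> Vector_Spaces.linear sh sg T"
proof
  assume "cochain_of_map T \<in> C 1"
  then have "Vector_Spaces.linear sh sg (\<lambda>x. cochain_of_map T (x # []))"
    using multilinear_head[OF C_multilinear] by blast
  then show "Vector_Spaces.linear sh sg T" by (simp add: cochain_of_map_def)
next
  assume T: "Vector_Spaces.linear sh sg T"
  have "Vector_Spaces.linear sh sg (\<lambda>x. cochain_of_map T (a @ x # b))" for a b
    using T linear_const_zero[OF vector_spaces] by (cases "a = [] \<and> b = []") (auto simp: cochain_of_map_def)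
  then show "cochain_of_map T \<in> C 1"
    by (auto simp: C_iff multilinear_def cochain_of_map_def)
qed

lemma cochain_of_map_surj:
  assumes "\<alpha> \<in> C 1" shows "\<alpha> = cochain_of_map (\<lambda>v. \<alpha> [v])"
proof
  fix vs
  show "\<alpha> vs = cochain_of_map (\<lambda>v. \<alpha> [v]) vs"
    using C_support[OF assms, of vs] by (cases vs) (auto simp: cochain_of_map_def)
qed

text \<open>The curvature of a cochain of degree 1 is a bilinear map. At \<open>(u, v)\<close> both occurrences of
  \<open>T (\<rho> (T u) v)\<close> in the bracket coincide, and so do both orders of \<open>[T u, T v]\<close>, so the factor \<open>1/2\<close>
  cancels.\<close>

lemma maurer_cartan_iff:
  assumes two: "(2 :: 'k) \<noteq> 0" and T: "Vector_Spaces.linear sh sg T"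
  shows "maurer_cartan cscale Cdeg cb cd (cochain_of_map T) \<longleftrightarrow>
    (\<forall>u v. brg (T u) (T v) = T (\<rho> (T u) v + brh u v))"
proof -
  let ?a = "cochain_of_map T"
  let ?F = "cd ?a + cscale (1 / 2) (cb ?a ?a)"
  have a: "?a \<in> C 1" using T cochain_of_map_in_C by simp
  have eq: "cd ?a = hom_diff 1 ?a" "cb ?a ?a = hom_br 1 1 ?a ?a"
    using cd_hom[OF a] cb_hom[OF a a] by simp_all
  have F: "?F \<in> C 2"
    unfolding eq using hom_diff_in_C[OF a] hom_br_in_C[OF a a] by (simp add: C_add C_scale numeral_2_eq_2)
  have half: "sg (1 / 2) (x + x) = x" for x
  proof -
    have "sg (1 / 2) (x + x) = sg (1 / 2 + 1 / 2) x" by (simp only: g.scale_left_distrib g.scale_right_distrib)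
    then show ?thesis using two by (simp flip: add_divide_distrib)
  qed
  have Tadd: "T (x + y) = T x + T y" for x y using T by (simp add: linear_unfold)
  have d: "cd ?a [u, v] = - T (brh u v)" for u v
    unfolding eq hom_d_eq[OF a order_refl]
    by (simp add: psgn_apply mirror_def leib_def ad_def cochain_of_map_def) (simp add: psgn_def)
  have b: "cb ?a ?a [u, v] = (brg (T u) (T v) - T (\<rho> (T u) v)) + (brg (T u) (T v) - T (\<rho> (T u) v))" for u v
    unfolding eq hom_bracket_eq[OF a a] using brg_anti[of "T v" "T u"]
    by (simp add: mirror_def subadj_def act_def conv_def psgn_apply cochain_of_map_def brg_zero) (simp add: psgn_def)
  have val: "?F [u, v] = brg (T u) (T v) - T (\<rho> (T u) v + brh u v)" for u v
    by (simp add: d b cscale_apply half Tadd)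
  have "?F = 0 \<longleftrightarrow> (\<forall>u v. ?F [u, v] = 0)"
  proof
    assume *: "\<forall>u v. ?F [u, v] = 0"
    show "?F = 0"
    proof
      fix vs
      show "?F vs = 0 vs"
      proof (cases "length vs = 2")
        case True
        then obtain u v where "vs = [u, v]" by (auto simp: length_Suc_conv numeral_2_eq_2)
        then show ?thesis using * by simp
      qed (use C_support[OF F] in simp)
    qed
  qed simp
  also have "\<dots> \<longleftrightarrow> (\<forall>u v. brg (T u) (T v) = T (\<rho> (T u) v + brh u v))"
    by (simp only: val right_minus_eq)
  finally show ?thesis
    using a by (simp add: maurer_cartan_def cochain_deg_def)
qed

end

theorem theorem4p2:
  fixes sg :: "'k::field_char_0 \<Rightarrow> 'g::ab_group_add \<Rightarrow> 'g"
    and brg :: "'g \<Rightarrow> 'g \<Rightarrow> 'g"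
    and sh :: "'k \<Rightarrow> 'h::ab_group_add \<Rightarrow> 'h"
    and brh :: "'h \<Rightarrow> 'h \<Rightarrow> 'h"
    and \<rho> :: "'g \<Rightarrow> 'h \<Rightarrow> 'h"
  assumes "coherent_action sg brg sh brh \<rho>"
  shows "dg_lie_algebra (cochain_scale sg) (cochains sh sg) (cochain_deg sh sg)
           (cochain_bracket sg brg \<rho>) (cochain_d sg brh)
         \<and> bij_betw cochain_of_map
           {T. nonabelian_embedding_tensor sg brg sh brh \<rho> T}
           {\<alpha>. maurer_cartan (cochain_scale sg) (cochain_deg sh sg)
                 (cochain_bracket sg brg \<rho>) (cochain_d sg brh) \<alpha>}"
proof
  interpret coherent_action sg brg sh brh \<rho> by fact
  show "dg_lie_algebra cscale V Cdeg cb cd"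
    by (rule dg_lie_algebra_cochains) simp
  have MC: "maurer_cartan cscale Cdeg cb cd (cochain_of_map T) \<longleftrightarrow> nonabelian_embedding_tensor sg brg sh brh \<rho> T" for T
  proof (cases "Vector_Spaces.linear sh sg T")
    case True
    then show ?thesis by (simp add: maurer_cartan_iff nonabelian_embedding_tensor_def)
  next
    case False
    then have "cochain_of_map T \<notin> C 1" using cochain_of_map_in_C by blast
    then show ?thesis using False
      by (simp add: maurer_cartan_def nonabelian_embedding_tensor_def cochain_deg_def)
  qed
  show "bij_betw cochain_of_map {T. nonabelian_embedding_tensor sg brg sh brh \<rho> T}
     {\<alpha>. maurer_cartan cscale Cdeg cb cd \<alpha>}"
  proof (rule bij_betw_byWitness[where f' = "\<lambda>\<alpha> v. \<alpha> [v]"])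
    show "\<forall>T\<in>{T. nonabelian_embedding_tensor sg brg sh brh \<rho> T}. (\<lambda>v. cochain_of_map T [v]) = T"
      by (simp add: cochain_of_map_def)
    show surj: "\<forall>\<alpha>\<in>{\<alpha>. maurer_cartan cscale Cdeg cb cd \<alpha>}. cochain_of_map (\<lambda>v. \<alpha> [v]) = \<alpha>"
      using cochain_of_map_surj by (auto simp: maurer_cartan_def cochain_deg_def)
    show "cochain_of_map ` {T. nonabelian_embedding_tensor sg brg sh brh \<rho> T} \<subseteq> {\<alpha>. maurer_cartan cscale Cdeg cb cd \<alpha>}"
      by (auto simp: MC)
    show "(\<lambda>\<alpha> v. \<alpha> [v]) ` {\<alpha>. maurer_cartan cscale Cdeg cb cd \<alpha>} \<subseteq> {T. nonabelian_embedding_tensor sg brg sh brh \<rho> T}"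
      using surj by (auto simp flip: MC)
  qed
qed

end
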